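(* Let $A,B$ be $n\times n$ positive definite matrices and let $t\in[-\tfrac12,0]\cup[1,\tfrac32]$. Then \[ A\,\widehat{sp}_t\,B\prec_{\log}A^{\frac{1-t}{2}}B^tA^{\frac{1-t}{2}}. \]
   Context: For positive definite matrices $A,B$ and $t\in\mathbb{R}$: $A\sharp B:=A^{1/2}(A^{-1/2}BA^{-1/2})^{1/2}A^{1/2}$ and $A\,\widehat{sp}_t\,B:=(A^{-1}\sharp B)^tA(A^{-1}\sharp B)^t$. For $n\times n$ positive semidefinite matrices $X,Y$ with eigenvalues $\lambda_1(\cdot)\ge\dots\ge\lambda_n(\cdot)$, $X\prec_{\log}Y$ means $\prod_{j=1}^k\lambda_j(X)\le\prod_{j=1}^k\lambda_j(Y)$ for $k=1,\dots,n-1$ and $\det X=\det Y$. *)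

theory Defs
  imports "Jordan_Normal_Form.Schur_Decomposition" "HOL-Computational_Algebra.Polynomial"
begin

definition hermitian_mat :: "complex mat \<Rightarrow> bool" where
  "hermitian_mat A \<longleftrightarrow> A \<in> carrier_mat (dim_row A) (dim_row A) \<and> mat_adjoint A = A"

definition pos_def_mat :: "complex mat \<Rightarrow> bool" where
  "pos_def_mat A \<longleftrightarrow> hermitian_mat A \<and>
     (\<forall>v \<in> carrier_vec (dim_row A). v \<noteq> 0\<^sub>v (dim_row A) \<longrightarrow>
        Im ((A *\<^sub>v v) \<bullet> conjugate v) = 0 \<and> Re ((A *\<^sub>v v) \<bullet> conjugate v) > 0)"

definition unitary_mat :: "complex mat \<Rightarrow> bool" where
  "unitary_mat U \<longleftrightarrow> U \<in> carrier_mat (dim_row U) (dim_row U) \<and>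
     U * mat_adjoint U = 1\<^sub>m (dim_row U) \<and> mat_adjoint U * U = 1\<^sub>m (dim_row U)"

definition diag_of :: "nat \<Rightarrow> (nat \<Rightarrow> complex) \<Rightarrow> complex mat" where
  "diag_of n d = mat n n (\<lambda>(i,j). if i = j then d i else 0)"

text \<open>Real power A^s of a positive definite matrix via the spectral decomposition
  A = U diag(d) U^*, A^s = U diag(d^s) U^* (independent of the chosen decomposition).\<close>
definition mat_powr :: "complex mat \<Rightarrow> real \<Rightarrow> complex mat" where
  "mat_powr A s = (SOME X. \<exists>U d. unitary_mat U \<and> dim_row U = dim_row A \<and>
      (\<forall>i < dim_row A. d i > 0) \<and>
      A = U * diag_of (dim_row A) (\<lambda>i. complex_of_real (d i)) * mat_adjoint U \<and>
      X = U * diag_of (dim_row A) (\<lambda>i. complex_of_real (d i powr s)) * mat_adjoint U)"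

definition mat_inv :: "complex mat \<Rightarrow> complex mat" where
  "mat_inv A = (SOME X. X \<in> carrier_mat (dim_row A) (dim_row A) \<and>
       A * X = 1\<^sub>m (dim_row A) \<and> X * A = 1\<^sub>m (dim_row A))"

definition geo_mean :: "complex mat \<Rightarrow> complex mat \<Rightarrow> complex mat" where
  "geo_mean A B = mat_powr A (1/2) *
      mat_powr (mat_powr A (-1/2) * B * mat_powr A (-1/2)) (1/2) * mat_powr A (1/2)"

definition sp_hat :: "real \<Rightarrow> complex mat \<Rightarrow> complex mat \<Rightarrow> complex mat" where
  "sp_hat t A B = mat_powr (geo_mean (mat_inv A) B) t * A * mat_powr (geo_mean (mat_inv A) B) t"

definition eigs :: "complex mat \<Rightarrow> real list" where
  "eigs X = (SOME L. length L = dim_row X \<and> sorted_wrt (\<ge>) L \<and>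
      char_poly X = (\<Prod>x\<leftarrow>L. [:- complex_of_real x, 1:]))"

definition log_majorized :: "complex mat \<Rightarrow> complex mat \<Rightarrow> bool" where
  "log_majorized X Y \<longleftrightarrow>
     (\<forall>k \<in> {1..dim_row X - 1}. (\<Prod>j<k. eigs X ! j) \<le> (\<Prod>j<k. eigs Y ! j)) \<and>
     det X = det Y"

end

theory Submission
  imports Defs
begin

text \<open>
  Put \<open>C = A\<^sup>-\<^sup>1 \<sharp> B\<close>, so that \<open>C A C = B\<close>. For \<open>t = -s \<le> 0\<close> let \<open>c\<close> be the largest eigenvalue of
  \<open>C\<^sup>-\<^sup>s A C\<^sup>-\<^sup>s\<close> and \<open>\<mu>\<close> that of \<open>B\<^bsup>-s/2\<^esup> A\<^bsup>1+s\<^esup> B\<^bsup>-s/2\<^esup>\<close>. Then \<open>A \<le> c C\<^bsup>2s\<^esup>\<close>, hence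
  \<open>B\<^sup>s = (C A C)\<^sup>s \<le> c\<^sup>s C\<^bsup>2s(1+s)\<^esup>\<close> by the Loewner-Heinz inequality, and \<open>A\<^bsup>1+s\<^esup> \<le> \<mu> B\<^sup>s\<close>. Combining
  these and applying Loewner-Heinz with exponent \<open>1/(1+s)\<close> gives \<open>A \<le> (\<mu> c\<^sup>s)\<^bsup>1/(1+s)\<^esup> C\<^bsup>2s\<^esup>\<close>, so \<open>c \<le> \<mu>\<close>
  because \<open>c\<close> is least possible. Products of the \<open>k\<close> largest eigenvalues are largest eigenvalues of
  \<open>k\<close>-th compound matrices, and compounds commute with products and real powers. The case \<open>t \<ge> 1\<close>
  is the case \<open>1 - t \<le> 0\<close> with \<open>A\<close> and \<open>B\<close> exchanged and \<open>C\<close> inverted.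
\<close>

section \<open>Unitary diagonalization of Hermitian matrices\<close>

text \<open>The powers of \<open>C\<close> have no algebraic link to those of \<open>A\<close> and
  \<open>B\<close>; the quadratic relation \<open>C * A * C = B\<close> is the only bridge, and
  Loewner-Heinz carries inequalities across it only with exponents in \<open>[0,1]\<close>. Two such
  exponents, \<open>s\<close> and \<open>1 / (1 + s)\<close>, fit together because the congruence by
  \<open>C\<close> shifts the exponent \<open>2 * s\<close> to \<open>2 * (1 + s)\<close>: taking
  the power \<open>s\<close> and then the power \<open>1 / (1 + s)\<close> leads back to
  \<open>2 * s\<close>. The estimate thus bounds \<open>c\<close> in terms of itself, and the
  surplus factor \<open>c powr s\<close> cancels. The eigenvalue comparison is phrased in
  \<open>A\<close>, \<open>C\<close> and \<open>C * A * C\<close> alone. These expressions are built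
  from products and real powers, so they survive the passage to compounds; no compound of a
  geometric mean has to be computed. The estimate wants the outer factors to be powers of
  \<open>C * A * C\<close>, whereas for \<open>t <= 0\<close> the theorem has powers of
  \<open>A\<close> outside; the two arrangements have the same spectrum. Powers, inverses and
  eigenvalue lists are all given by choice, which is why existence and uniqueness of the spectral
  calculus come first.\<close>

lemma mat_adjoint_conv_mat:
  "mat_adjoint A = mat (dim_col A) (dim_row A) (\<lambda>(i,j). cnj (A $$ (j,i)))"
  by (rule eq_matI) (auto simp: mat_adjoint_def mat_of_rows_def)

lemma mat_adjoint_dim [simp]:
  fixes A :: "complex mat"
  shows "dim_row (mat_adjoint A) = dim_col A" "dim_col (mat_adjoint A) = dim_row A"
  by (simp_all add: mat_adjoint_conv_mat)

lemma mat_adjoint_carrier [simp]: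
  fixes A :: "complex mat"
  shows "A \<in> carrier_mat n m \<Longrightarrow> mat_adjoint A \<in> carrier_mat m n"
  unfolding carrier_mat_def by simp

lemma mat_adjoint_index [simp]:
  "i < dim_col A \<Longrightarrow> j < dim_row A \<Longrightarrow> mat_adjoint A $$ (i,j) = cnj (A $$ (j,i))"
  by (simp add: mat_adjoint_conv_mat)

lemma mat_adjoint_adjoint [simp]:
  fixes A :: "complex mat"
  shows "mat_adjoint (mat_adjoint A) = A"
  by (rule eq_matI) auto

lemma square_mult_carrier:
  "A \<in> carrier_mat n n \<Longrightarrow> B \<in> carrier_mat n n \<Longrightarrow> A * B \<in> carrier_mat n n"
  by (rule mult_carrier_mat)

lemma square_mult_assoc:
  fixes A B C :: "'a :: semiring_0 mat"
  shows "A \<in> carrier_mat n n \<Longrightarrow> B \<in> carrier_mat n n \<Longrightarrow> C \<in> carrier_mat n n \<Longrightarrow>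
    A * B * C = A * (B * C)"
  by (rule assoc_mult_mat)

lemma mat_adjoint_mult:
  fixes A B :: "complex mat"
  assumes "A \<in> carrier_mat n m" "B \<in> carrier_mat m k"
  shows "mat_adjoint (A * B) = mat_adjoint B * mat_adjoint A"
  using assms by (intro eq_matI) (auto simp: scalar_prod_def mult.commute intro!: sum.cong)

lemma cscalar_mat_adjoint:
  fixes A :: "complex mat"
  assumes "A \<in> carrier_mat n m" "v \<in> carrier_vec m" "w \<in> carrier_vec n"
  shows "(A *\<^sub>v v) \<bullet>c w = v \<bullet>c (mat_adjoint A *\<^sub>v w)"
proof -
  have "(A *\<^sub>v v) \<bullet>c w = (\<Sum>i<n. \<Sum>j<m. A $$ (i,j) * v $ j * cnj (w $ i))"
    using assms by (auto simp: scalar_prod_def sum_distrib_right atLeast0LessThan intro!: sum.cong)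
  also have "\<dots> = (\<Sum>j<m. \<Sum>i<n. A $$ (i,j) * v $ j * cnj (w $ i))"
    by (rule sum.swap)
  also have "\<dots> = v \<bullet>c (mat_adjoint A *\<^sub>v w)"
    using assms by (auto simp: scalar_prod_def sum_distrib_left atLeast0LessThan ac_simps intro!: sum.cong)
  finally show ?thesis .
qed

lemma cscalar_sq_norm:
  fixes v :: "complex vec"
  shows "v \<bullet>c v = complex_of_real (\<Sum>i<dim_vec v. (cmod (v $ i))\<^sup>2)"
  by (simp add: scalar_prod_def complex_norm_square atLeast0LessThan flip: of_real_power)

section \<open>Diagonal matrices\<close>

lemma diag_of_carrier [simp]: "diag_of n d \<in> carrier_mat n n"
  by (simp add: diag_of_def)

lemma diag_of_dim [simp]: "dim_row (diag_of n d) = n" "dim_col (diag_of n d) = n"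
  by (simp_all add: diag_of_def)

lemma diag_of_index [simp]:
  "i < n \<Longrightarrow> j < n \<Longrightarrow> diag_of n d $$ (i,j) = (if i = j then d i else 0)"
  by (simp add: diag_of_def)

lemma diag_of_mult_left:
  assumes "M \<in> carrier_mat n m" "i < n" "j < m"
  shows "(diag_of n d * M) $$ (i,j) = d i * M $$ (i,j)"
  using assms by (simp add: scalar_prod_def atLeast0LessThan if_distrib[of "\<lambda>x. x * _"] cong: if_cong)

lemma diag_of_mult_right:
  assumes "M \<in> carrier_mat m n" "i < m" "j < n"
  shows "(M * diag_of n d) $$ (i,j) = M $$ (i,j) * d j"
  using assms by (simp add: scalar_prod_def atLeast0LessThan if_distrib[of "\<lambda>x. _ * x"] cong: if_cong)

lemma diag_of_mult_diag_of: "diag_of n d * diag_of n e = diag_of n (\<lambda>i. d i * e i)"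
  by (rule eq_matI) (auto simp: diag_of_mult_left[where n = n and m = n] simp del: index_mult_mat(1))

lemma diag_of_mult_vec:
  assumes "v \<in> carrier_vec n" "i < n"
  shows "(diag_of n d *\<^sub>v v) $ i = d i * v $ i"
  using assms by (simp add: scalar_prod_def atLeast0LessThan if_distrib[of "\<lambda>x. x * _"] cong: if_cong)

lemma diag_of_one: "diag_of n (\<lambda>_. 1) = 1\<^sub>m n"
  by (rule eq_matI) auto

lemma mat_adjoint_diag_of_real [simp]:
  "mat_adjoint (diag_of n (\<lambda>i. complex_of_real (d i))) = diag_of n (\<lambda>i. complex_of_real (d i))"
  by (rule eq_matI) auto

text \<open>Provides the change of basis for deflation. Completing \<open>v\<close> to a basis and
  orthogonalizing keeps the direction of the first vector; normalization rescales it, hence the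
  unspecified factor \<open>c\<close>.\<close>

lemma unitary_extension:
  fixes v :: "complex vec"
  assumes v: "v \<in> carrier_vec n" and v0: "v \<noteq> 0\<^sub>v n"
  obtains W c where "W \<in> carrier_mat n n" "mat_adjoint W * W = 1\<^sub>m n" "W * mat_adjoint W = 1\<^sub>m n"
    "col W 0 = c \<cdot>\<^sub>v v"
proof -
  interpret cof_vec_space n "TYPE(complex)" .
  define b where "b = basis_completion v"
  define ws where "ws = gram_schmidt n b"
  from basis_completion[OF v v0, folded b_def]
  have dist_b: "distinct b" and indep: "\<not> lin_dep (set b)" and b: "set b \<subseteq> carrier_vec n"
    and hdb: "hd b = v" and len_b: "length b = n" by auto
  have n: "n > 0" using v v0 by (cases n) auto
  with hdb len_b obtain vs where bv: "b = v # vs" by (cases b) auto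
  from gram_schmidt_result[OF b dist_b indep refl, folded ws_def]
  have ws: "set ws \<subseteq> carrier_vec n" "corthogonal ws" "length ws = n"
    by (auto simp: len_b)
  from gram_schmidt_hd[OF v, of vs, folded bv] have hdws: "hd ws = v" unfolding ws_def .
  have wsc: "ws ! j \<in> carrier_vec n" if "j < n" for j using ws that by auto
  \<comment> \<open>Gram-Schmidt yields orthogonal vectors of arbitrary length, so each column has
    to be divided by its norm.\<close>
  define N where "N j = sqrt (\<Sum>i<n. (cmod (ws ! j $ i))\<^sup>2)" for j
  have Nsq: "complex_of_real (N j) * complex_of_real (N j) = ws ! j \<bullet>c ws ! j" if "j < n" for j
  proof -
    have "dim_vec (ws ! j) = n" using wsc[OF that] by auto
    then have "ws ! j \<bullet>c ws ! j = complex_of_real (\<Sum>i<n. (cmod (ws ! j $ i))\<^sup>2)"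
      by (simp only: cscalar_sq_norm)
    moreover have "N j * N j = (\<Sum>i<n. (cmod (ws ! j $ i))\<^sup>2)"
      unfolding N_def by (simp add: sum_nonneg)
    ultimately show ?thesis by (metis of_real_mult)
  qed
  have N0: "N j \<noteq> 0" if "j < n" for j
    using Nsq[OF that] corthogonalD[OF ws(2), of j j] that ws(3) by auto
  define W where "W = mat n n (\<lambda>(i,j). ws ! j $ i / complex_of_real (N j))"
  have W: "W \<in> carrier_mat n n" by (simp add: W_def)
  have WW: "mat_adjoint W * W = 1\<^sub>m n"
  proof (rule eq_matI)
    fix i j assume "i < dim_row (1\<^sub>m n :: complex mat)" "j < dim_col (1\<^sub>m n :: complex mat)"
    then have ij: "i < n" "j < n" by auto
    have "(mat_adjoint W * W) $$ (i,j) =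
        (\<Sum>k<n. cnj (ws ! i $ k) * ws ! j $ k / (complex_of_real (N i) * complex_of_real (N j)))"
      using ij by (auto simp: W_def scalar_prod_def atLeast0LessThan intro!: sum.cong)
    also have "\<dots> = (ws ! j \<bullet>c ws ! i) / (complex_of_real (N i) * complex_of_real (N j))"
      using wsc[OF ij(1)] wsc[OF ij(2)]
      by (auto simp: scalar_prod_def atLeast0LessThan sum_divide_distrib mult.commute intro!: sum.cong)
    also have "\<dots> = 1\<^sub>m n $$ (i,j)"
    proof (cases "i = j")
      case True
      then show ?thesis using Nsq[OF ij(1)] N0[OF ij(1)] ij by auto
    next
      case False
      then show ?thesis using corthogonalD[OF ws(2), of j i] ij ws(3) by auto
    qed
    finally show "(mat_adjoint W * W) $$ (i,j) = 1\<^sub>m n $$ (i,j)" .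
  qed (use W in auto)
  have "W * mat_adjoint W = 1\<^sub>m n"
    using mat_mult_left_right_inverse[OF _ W WW] W by auto
  moreover have "col W 0 = (1 / complex_of_real (N 0)) \<cdot>\<^sub>v v"
  proof -
    have "ws ! 0 = v" using hdws ws(3) n by (cases ws) auto
    then show ?thesis using n v by (intro eq_vecI) (auto simp: W_def)
  qed
  ultimately show ?thesis using that W WW by blast
qed

text \<open>The list \<open>es\<close> is a parameter so that later the sorted list \<open>eigs A\<close> can itself serve as the diagonal.\<close>

lemma hermitian_diagonalization:
  fixes A :: "complex mat"
  assumes "A \<in> carrier_mat n n" "mat_adjoint A = A" "char_poly A = (\<Prod>e\<leftarrow>es. [:- e, 1:])"
  shows "\<exists>U \<in> carrier_mat n n. U * mat_adjoint U = 1\<^sub>m n \<and> mat_adjoint U * U = 1\<^sub>m n \<and>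
    A = U * diag_of n ((!) es) * mat_adjoint U"
  using assms
proof (induction es arbitrary: n A)
  case Nil
  then have "n = 0" using degree_monic_char_poly[of A n] by auto
  then show ?case using Nil(1) by (intro bexI[of _ "1\<^sub>m 0"]) (auto intro!: eq_matI)
next
  case (Cons e es)
  note A = Cons.prems(1) and herm = Cons.prems(2)
  have cp: "char_poly A = [:- e, 1:] * (\<Prod>e\<leftarrow>es. [:- e, 1:])" using Cons.prems by simp
  have ev: "eigenvalue A e" unfolding eigenvalue_root_char_poly[OF A] cp by simp
  then obtain v where v: "v \<in> carrier_vec n" and v0: "v \<noteq> 0\<^sub>v n" and Av: "A *\<^sub>v v = e \<cdot>\<^sub>v v"
    using A unfolding eigenvalue_def eigenvector_def by auto
  have n: "n > 0" using v v0 by (cases n) auto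
  define m where "m = n - 1"
  have nm: "n = Suc m" using n by (simp add: m_def)
  obtain W c where W: "W \<in> carrier_mat n n" and WW: "mat_adjoint W * W = 1\<^sub>m n"
    and WW': "W * mat_adjoint W = 1\<^sub>m n" and colW: "col W 0 = c \<cdot>\<^sub>v v"
    using unitary_extension[OF v v0] by blast
  have W': "mat_adjoint W \<in> carrier_mat n n" using W by simp
  \<comment> \<open>Deflation: column 0 of \<open>W\<close> is an eigenvector, so column 0 of
    \<open>A'\<close> is \<open>e\<close> times a unit vector. Hermiticity then clears row 0 as
    well, and the remaining block is Hermitian with the remaining roots \<open>es\<close>.\<close>
  define A' where "A' = mat_adjoint W * A * W"
  have A': "A' \<in> carrier_mat n n" using A W W' by (simp add: A'_def square_mult_carrier)
  have herm': "mat_adjoint A' = A'"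
    unfolding A'_def using A W W' herm
    by (simp add: mat_adjoint_mult[of _ n n _ n] square_mult_assoc[of _ n] square_mult_carrier[of _ n])
  have AWA: "A = W * A' * mat_adjoint W"
  proof -
    have "W * A' * mat_adjoint W = (W * mat_adjoint W) * A * (W * mat_adjoint W)"
      unfolding A'_def using A W W' by (simp add: square_mult_assoc[of _ n] square_mult_carrier[of _ n])
    then show ?thesis using WW' A by simp
  qed
  have col0: "A' $$ (i,0) = (if i = 0 then e else 0)" if "i < n" for i
  proof -
    have "col A' 0 = mat_adjoint W *\<^sub>v (A *\<^sub>v col W 0)"
    proof -
      have "A' = mat_adjoint W * (A * W)" unfolding A'_def using A W W' by (simp add: square_mult_assoc[of _ n])
      then have "col A' 0 = mat_adjoint W *\<^sub>v col (A * W) 0"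
        using A W W' n square_mult_carrier[OF A W] col_mult2[of "mat_adjoint W" n n "A * W" n 0] by simp
      also have "col (A * W) 0 = A *\<^sub>v col W 0" using A W n by (rule col_mult2)
      finally show ?thesis .
    qed
    also have "A *\<^sub>v col W 0 = e \<cdot>\<^sub>v col W 0"
      unfolding colW using A v by (simp add: mult_mat_vec Av smult_smult_assoc mult.commute)
    also have "mat_adjoint W *\<^sub>v (e \<cdot>\<^sub>v col W 0) = e \<cdot>\<^sub>v col (mat_adjoint W * W) 0"
      using W W' n by (simp add: mult_mat_vec[of _ n n] col_mult2[of _ n n _ n])
    also have "\<dots> = e \<cdot>\<^sub>v unit_vec n 0" using n by (simp add: WW)
    finally have "col A' 0 $ i = (e \<cdot>\<^sub>v unit_vec n 0) $ i" by simp
    then show ?thesis using A' that n by (auto simp: unit_vec_def)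
  qed
  have row0: "A' $$ (0,i) = 0" if "i < n" "i > 0" for i
  proof -
    have "A' $$ (0,i) = mat_adjoint A' $$ (0,i)" by (simp add: herm')
    also have "\<dots> = cnj (A' $$ (i,0))" using A' that by (intro mat_adjoint_index) auto
    finally show ?thesis using col0[OF that(1)] that by simp
  qed
  define A3 where "A3 = mat m m (\<lambda>(i,j). A' $$ (Suc i, Suc j))"
  have A3: "A3 \<in> carrier_mat m m" by (simp add: A3_def)
  define E where "E = mat 1 1 (\<lambda>_. e)"
  have E: "E \<in> carrier_mat 1 1" by (simp add: E_def)
  have block: "A' = four_block_mat E (0\<^sub>m 1 m) (0\<^sub>m m 1) A3"
  proof (rule eq_matI)
    fix i j assume "i < dim_row (four_block_mat E (0\<^sub>m 1 m) (0\<^sub>m m 1) A3)"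
      "j < dim_col (four_block_mat E (0\<^sub>m 1 m) (0\<^sub>m m 1) A3)"
    then have "i < n" "j < n" by (auto simp: E_def A3_def nm)
    then show "A' $$ (i,j) = four_block_mat E (0\<^sub>m 1 m) (0\<^sub>m m 1) A3 $$ (i,j)"
      using col0[of i] row0[of j] nm by (auto simp: E_def A3_def)
  qed (use A' nm in \<open>auto simp: E_def A3_def\<close>)
  have herm3: "mat_adjoint A3 = A3"
  proof (rule eq_matI)
    fix i j assume ij: "i < dim_row A3" "j < dim_col A3"
    then have "mat_adjoint A' $$ (Suc i, Suc j) = cnj (A' $$ (Suc j, Suc i))"
      using A' nm by (intro mat_adjoint_index) (auto simp: A3_def)
    then show "mat_adjoint A3 $$ (i,j) = A3 $$ (i,j)" using ij herm' by (simp add: A3_def)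
  qed (auto simp: A3_def)
  have "similar_mat A A'"
    unfolding similar_mat_def similar_mat_wit_def
    using A A' W W' WW WW' AWA by (intro exI[of _ W] exI[of _ "mat_adjoint W"]) (auto simp: Let_def)
  then have "char_poly A = char_poly A'" by (rule char_poly_similar)
  also have "\<dots> = char_poly E * char_poly A3"
    unfolding block by (rule char_poly_four_block_zeros_col[OF E _ A3]) simp
  also have "char_poly E = [:- e, 1:]" by (simp add: E_def char_poly_defs det_def sign_def)
  finally have "char_poly A3 = (\<Prod>e\<leftarrow>es. [:- e, 1:])"
    using cp by (metis mult_cancel_left pCons_eq_0_iff zero_neq_one)
  from Cons.IH[OF A3 herm3 this] obtain V where V: "V \<in> carrier_mat m m"
    and VV': "V * mat_adjoint V = 1\<^sub>m m" and VV: "mat_adjoint V * V = 1\<^sub>m m"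
    and A3V: "A3 = V * diag_of m ((!) es) * mat_adjoint V" by blast
  have V': "mat_adjoint V \<in> carrier_mat m m" using V by simp
  define V1 where "V1 = four_block_mat (1\<^sub>m 1) (0\<^sub>m 1 m) (0\<^sub>m m 1) V"
  have V1: "V1 \<in> carrier_mat n n" unfolding V1_def nm using V by auto
  have V1': "mat_adjoint V1 = four_block_mat (1\<^sub>m 1) (0\<^sub>m 1 m) (0\<^sub>m m 1) (mat_adjoint V)"
    unfolding V1_def using V by (intro eq_matI) auto
  have D: "diag_of n ((!) (e # es)) = four_block_mat E (0\<^sub>m 1 m) (0\<^sub>m m 1) (diag_of m ((!) es))"
    by (intro eq_matI) (auto simp: nm E_def)
  have one: "four_block_mat (1\<^sub>m 1) (0\<^sub>m 1 m) (0\<^sub>m m 1) (1\<^sub>m m) = 1\<^sub>m n"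
    by (intro eq_matI) (auto simp: nm)
  have mult: "four_block_mat P (0\<^sub>m 1 m) (0\<^sub>m m 1) Q * four_block_mat P' (0\<^sub>m 1 m) (0\<^sub>m m 1) Q' =
      four_block_mat (P * P') (0\<^sub>m 1 m) (0\<^sub>m m 1) (Q * Q')"
    if "P \<in> carrier_mat 1 1" "P' \<in> carrier_mat 1 1" "Q \<in> carrier_mat m m" "Q' \<in> carrier_mat m m"
    for P P' Q Q' :: "complex mat"
    using that by (subst mult_four_block_mat[of _ 1 1 _ m _ m _ _ 1 _ m]) auto
  have U1: "V1 * mat_adjoint V1 = 1\<^sub>m n"
    unfolding V1' unfolding V1_def using V V' by (subst mult) (auto simp: VV' one nm)
  have U2: "mat_adjoint V1 * V1 = 1\<^sub>m n"
    unfolding V1' unfolding V1_def using V V' by (subst mult) (auto simp: VV one nm)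
  have A'V: "A' = V1 * diag_of n ((!) (e # es)) * mat_adjoint V1"
    unfolding V1' unfolding V1_def D block A3V using V V' E
    by (simp add: mult square_mult_carrier[of _ m] del: One_nat_def)
  define U where "U = W * V1"
  have U: "U \<in> carrier_mat n n" using W V1 by (simp add: U_def square_mult_carrier)
  have U': "mat_adjoint U = mat_adjoint V1 * mat_adjoint W"
    unfolding U_def using W V1 by (rule mat_adjoint_mult)
  have V1a: "mat_adjoint V1 \<in> carrier_mat n n" using V1 by simp
  have "U * mat_adjoint U = W * (V1 * mat_adjoint V1) * mat_adjoint W"
    unfolding U' unfolding U_def using W V1 W' V1a by (simp add: square_mult_assoc[of _ n] square_mult_carrier[of _ n])
  moreover have "mat_adjoint U * U = mat_adjoint V1 * (mat_adjoint W * W) * V1"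
    unfolding U' unfolding U_def using W V1 W' V1a by (simp add: square_mult_assoc[of _ n] square_mult_carrier[of _ n])
  moreover have "A = U * diag_of n ((!) (e # es)) * mat_adjoint U"
    unfolding U' unfolding U_def AWA A'V using W V1 W' V1a by (simp add: square_mult_assoc[of _ n] square_mult_carrier[of _ n])
  ultimately show ?case using U W V1 V1a W' by (intro bexI[of _ U]) (auto simp: U1 U2 WW WW')
qed

section \<open>Positive definite matrices and their real powers\<close>

definition posdef :: "nat \<Rightarrow> complex mat \<Rightarrow> bool" where
  "posdef n A \<longleftrightarrow> A \<in> carrier_mat n n \<and> pos_def_mat A"

text \<open>The real part gives a real-valued function on all matrices; on Hermitian ones it loses
  nothing, see \<open>quad_form_hermitian\<close>.\<close>

definition quad_form :: "complex mat \<Rightarrow> complex vec \<Rightarrow> real" where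
  "quad_form A v = Re ((A *\<^sub>v v) \<bullet>c v)"

text \<open>The diagonal is neither sorted nor assumed positive: compounds deliver their eigenvalues
  in the order of the subset enumeration, and positivity is demanded separately where powers are
  formed.\<close>

definition spectral_decomp :: "nat \<Rightarrow> complex mat \<Rightarrow> complex mat \<Rightarrow> (nat \<Rightarrow> real) \<Rightarrow> bool" where
  "spectral_decomp n A U d \<longleftrightarrow> U \<in> carrier_mat n n \<and>
     U * mat_adjoint U = 1\<^sub>m n \<and> mat_adjoint U * U = 1\<^sub>m n \<and>
     A = U * diag_of n (\<lambda>i. complex_of_real (d i)) * mat_adjoint U"

lemma quad_form_hermitian:
  assumes "A \<in> carrier_mat n n" "mat_adjoint A = A" "v \<in> carrier_vec n"
  shows "(A *\<^sub>v v) \<bullet>c v = complex_of_real (quad_form A v)"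
proof -
  have Av: "A *\<^sub>v v \<in> carrier_vec n" using assms by simp
  have "(A *\<^sub>v v) \<bullet>c v = v \<bullet>c (A *\<^sub>v v)"
    using cscalar_mat_adjoint[OF assms(1,3,3)] assms(2) by simp
  also have "\<dots> = cnj ((A *\<^sub>v v) \<bullet>c v)"
    using Av assms(1,3) by (simp add: scalar_prod_def mult.commute del: index_mult_mat_vec)
  finally have "Im ((A *\<^sub>v v) \<bullet>c v) = - Im ((A *\<^sub>v v) \<bullet>c v)"
    using arg_cong[of _ _ Im] by (metis cnj.sel(2))
  then show ?thesis by (simp add: quad_form_def complex_eq_iff)
qed

lemma posdef_iff:
  "posdef n A \<longleftrightarrow> A \<in> carrier_mat n n \<and> mat_adjoint A = A \<and>
     (\<forall>v \<in> carrier_vec n. v \<noteq> 0\<^sub>v n \<longrightarrow> quad_form A v > 0)"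
proof (cases "A \<in> carrier_mat n n \<and> mat_adjoint A = A")
  case True
  then have "Im ((A *\<^sub>v v) \<bullet>c v) = 0" if "v \<in> carrier_vec n" for v
    using quad_form_hermitian[OF _ _ that, of A] by simp
  moreover have "dim_row A = n" using True by auto
  ultimately show ?thesis
    using True by (simp add: posdef_def pos_def_mat_def hermitian_mat_def quad_form_def)
next
  case False
  then show ?thesis by (auto simp: posdef_def pos_def_mat_def hermitian_mat_def)
qed

lemma posdefD:
  assumes "posdef n A"
  shows "A \<in> carrier_mat n n" "mat_adjoint A = A" "dim_row A = n" "dim_col A = n"
    "v \<in> carrier_vec n \<Longrightarrow> v \<noteq> 0\<^sub>v n \<Longrightarrow> quad_form A v > 0"
  using assms by (auto simp: posdef_iff)

lemma quad_form_one:
  assumes "v \<in> carrier_vec n"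
  shows "quad_form (1\<^sub>m n) v = (\<Sum>i<n. (cmod (v $ i))\<^sup>2)"
  using assms by (simp add: quad_form_def cscalar_sq_norm)

lemma quad_form_one_pos:
  assumes "v \<in> carrier_vec n" "v \<noteq> 0\<^sub>v n"
  shows "quad_form (1\<^sub>m n) v > 0"
proof -
  obtain i where "i < n" "v $ i \<noteq> 0"
    using assms by (metis carrier_vecD eq_vecI index_zero_vec)
  then show ?thesis unfolding quad_form_one[OF assms(1)] by (intro sum_pos2[of _ i]) auto
qed

section \<open>Quadratic forms under congruence and in an eigenbasis\<close>

lemma quad_form_congr:
  assumes "A \<in> carrier_mat n n" "Z \<in> carrier_mat n n" "v \<in> carrier_vec n"
  shows "quad_form (mat_adjoint Z * A * Z) v = quad_form A (Z *\<^sub>v v)"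
proof -
  have Z': "mat_adjoint Z \<in> carrier_mat n n" using assms by simp
  have AZ: "A *\<^sub>v (Z *\<^sub>v v) \<in> carrier_vec n" using assms by simp
  have "(mat_adjoint Z * A * Z) *\<^sub>v v = mat_adjoint Z *\<^sub>v (A *\<^sub>v (Z *\<^sub>v v))"
    using assms Z' by (simp add: square_mult_assoc[of _ n] assoc_mult_mat_vec[of _ n n _ n] square_mult_carrier[of _ n])
  then show ?thesis
    using cscalar_mat_adjoint[OF Z' AZ assms(3)] by (simp add: quad_form_def)
qed

lemma quad_form_diag:
  assumes "v \<in> carrier_vec n"
  shows "quad_form (diag_of n (\<lambda>i. complex_of_real (d i))) v = (\<Sum>i<n. d i * (cmod (v $ i))\<^sup>2)"
proof -
  have "(diag_of n (\<lambda>i. complex_of_real (d i)) *\<^sub>v v) \<bullet>c v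
      = (\<Sum>i<n. complex_of_real (d i) * (v $ i * cnj (v $ i)))"
    using assms by (simp add: scalar_prod_def atLeast0LessThan diag_of_mult_vec mult.assoc
      del: index_mult_mat_vec)
  also have "\<dots> = complex_of_real (\<Sum>i<n. d i * (cmod (v $ i))\<^sup>2)"
    by (simp add: complex_norm_square flip: of_real_power)
  finally show ?thesis by (simp add: quad_form_def)
qed

lemma spectral_decompD:
  assumes "spectral_decomp n A U d"
  shows "U \<in> carrier_mat n n" "mat_adjoint U \<in> carrier_mat n n" "U * mat_adjoint U = 1\<^sub>m n"
    "mat_adjoint U * U = 1\<^sub>m n"
    "A = U * diag_of n (\<lambda>i. complex_of_real (d i)) * mat_adjoint U" "A \<in> carrier_mat n n"
  using assms by (auto simp: spectral_decomp_def intro!: square_mult_carrier)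

lemma quad_form_spectral:
  assumes "spectral_decomp n A U d" "v \<in> carrier_vec n"
  shows "quad_form A v = (\<Sum>i<n. d i * (cmod ((mat_adjoint U *\<^sub>v v) $ i))\<^sup>2)"
proof -
  note U = spectral_decompD[OF assms(1)]
  have "quad_form A v = quad_form (diag_of n (\<lambda>i. complex_of_real (d i))) (mat_adjoint U *\<^sub>v v)"
    using quad_form_congr[OF diag_of_carrier U(2) assms(2)] U(5) by simp
  also have "\<dots> = (\<Sum>i<n. d i * (cmod ((mat_adjoint U *\<^sub>v v) $ i))\<^sup>2)"
    using U(2) assms(2) by (intro quad_form_diag) simp
  finally show ?thesis .
qed

text \<open>Combined with \<open>quad_form_spectral\<close> this is Parseval's identity in the
  eigenbasis of \<open>A\<close>.\<close>

lemma spectral_decomp_one: "spectral_decomp n A U d \<Longrightarrow> spectral_decomp n (1\<^sub>m n) U (\<lambda>_. 1)"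
  by (auto simp: spectral_decomp_def diag_of_one)

lemma spectral_decomp_posdef:
  assumes "spectral_decomp n A U d" "\<And>i. i < n \<Longrightarrow> d i > 0"
  shows "posdef n A"
proof -
  note U = spectral_decompD[OF assms(1)]
  have "mat_adjoint A = A"
    unfolding U(5) using U(1,2)
    by (simp add: mat_adjoint_mult[of _ n n _ n] square_mult_assoc[of _ n] square_mult_carrier[of _ n])
  moreover have "quad_form A v > 0" if v: "v \<in> carrier_vec n" "v \<noteq> 0\<^sub>v n" for v
  proof -
    let ?w = "mat_adjoint U *\<^sub>v v"
    have "(\<Sum>i<n. 1 * (cmod (?w $ i))\<^sup>2) > 0"
      using quad_form_spectral[OF spectral_decomp_one[OF assms(1)] v(1)] quad_form_one_pos[OF v]
      by simp
    then obtain i where i: "i < n" "?w $ i \<noteq> 0"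
      by (metis (no_types, lifting) lessThan_iff less_irrefl mult_eq_0_iff norm_zero sum.neutral zero_power2)
    show ?thesis
      unfolding quad_form_spectral[OF assms(1) v(1)]
    proof (rule sum_pos2[of _ i])
      show "0 < d i * (cmod (?w $ i))\<^sup>2" using i assms(2)[OF i(1)] by simp
    qed (use i assms(2) in \<open>auto simp: less_imp_le simp del: index_mult_mat_vec\<close>)
  qed
  ultimately show ?thesis using U(6) by (simp add: posdef_iff)
qed

text \<open>The columns of \<open>U\<close> are the test vectors of the proof: an inequality between
  quadratic forms, evaluated at column \<open>i\<close>, becomes an inequality for
  \<open>d i\<close>.\<close>

lemma spectral_decomp_col:
  assumes "spectral_decomp n A U d" "i < n"
  shows "col U i \<in> carrier_vec n" "col U i \<noteq> 0\<^sub>v n"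
    "A *\<^sub>v col U i = complex_of_real (d i) \<cdot>\<^sub>v col U i"
    "quad_form A (col U i) = d i" "quad_form (1\<^sub>m n) (col U i) = 1"
proof -
  note U = spectral_decompD[OF assms(1)]
  show c: "col U i \<in> carrier_vec n" using U(1) assms(2) by simp
  have e: "mat_adjoint U *\<^sub>v col U i = unit_vec n i"
    using col_mult2[OF U(2,1) assms(2)] U(4) assms(2) by simp
  have D: "diag_of n (\<lambda>i. complex_of_real (d i)) *\<^sub>v unit_vec n i = complex_of_real (d i) \<cdot>\<^sub>v unit_vec n i"
    using assms(2) by (intro eq_vecI) (auto simp: diag_of_mult_vec simp del: index_mult_mat_vec)
  have "A *\<^sub>v col U i = U *\<^sub>v (diag_of n (\<lambda>i. complex_of_real (d i)) *\<^sub>v (mat_adjoint U *\<^sub>v col U i))"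
    unfolding U(5) using U(1,2) c
    by (simp add: square_mult_assoc[of _ n] assoc_mult_mat_vec[of _ n n _ n] square_mult_carrier[of _ n])
  also have "\<dots> = complex_of_real (d i) \<cdot>\<^sub>v (U *\<^sub>v unit_vec n i)"
    unfolding e D using U(1) by (simp add: mult_mat_vec[of _ n n])
  also have "U *\<^sub>v unit_vec n i = col U i"
    using U(1) assms(2) by (intro eq_vecI) auto
  finally show "A *\<^sub>v col U i = complex_of_real (d i) \<cdot>\<^sub>v col U i" .
  have delta: "(\<Sum>j<n. f j * (cmod (unit_vec n i $ j))\<^sup>2) = f i" for f :: "nat \<Rightarrow> real"
  proof -
    have "(\<Sum>j<n. f j * (cmod (unit_vec n i $ j))\<^sup>2) = (\<Sum>j<n. if j = i then f j else 0)"
      using assms(2) by (intro sum.cong) auto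
    then show ?thesis using assms(2) by simp
  qed
  show "quad_form A (col U i) = d i"
    unfolding quad_form_spectral[OF assms(1) c] e by (rule delta)
  show one: "quad_form (1\<^sub>m n) (col U i) = 1"
    unfolding quad_form_spectral[OF spectral_decomp_one[OF assms(1)] c] e by (rule delta)
  show "col U i \<noteq> 0\<^sub>v n"
  proof
    assume "col U i = 0\<^sub>v n"
    then show False using one by (simp add: quad_form_one)
  qed
qed

lemma posdef_eigenvalue_pos:
  assumes "posdef n A" "eigenvalue A e"
  shows "e = complex_of_real (Re e)" "Re e > 0"
proof -
  note A = posdefD[OF assms(1)]
  obtain v where v: "v \<in> carrier_vec n" "v \<noteq> 0\<^sub>v n" and Av: "A *\<^sub>v v = e \<cdot>\<^sub>v v"
    using assms(2) A(3) unfolding eigenvalue_def eigenvector_def by auto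
  have "complex_of_real (quad_form A v) = e * (v \<bullet>c v)"
    using quad_form_hermitian[OF A(1,2) v(1)] v(1) by (simp add: Av)
  also have "v \<bullet>c v = complex_of_real (quad_form (1\<^sub>m n) v)"
    using v(1) by (simp add: quad_form_one cscalar_sq_norm)
  finally have eq: "complex_of_real (quad_form A v) = e * complex_of_real (quad_form (1\<^sub>m n) v)" .
  have "Re e * quad_form (1\<^sub>m n) v = quad_form A v" "Im e * quad_form (1\<^sub>m n) v = 0"
    using arg_cong[OF eq, of Re] arg_cong[OF eq, of Im] by auto
  moreover have "quad_form A v > 0" using A(5)[OF v] .
  ultimately show "e = complex_of_real (Re e)" "Re e > 0"
    using quad_form_one_pos[OF v] by (auto simp: complex_eq_iff zero_less_mult_iff dest: sym)
qed

text \<open>Since \<open>eigs\<close> is a choice, a suitable list has to be exhibited: the complex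
  roots of the characteristic polynomial are real for a positive definite matrix, and their real
  parts are sorted in decreasing order.\<close>

lemma spectral_decomp_eigs:
  assumes "posdef n A"
  shows "\<exists>U. spectral_decomp n A U ((!) (eigs A))" "length (eigs A) = n"
    "sorted_wrt (\<ge>) (eigs A)" "\<And>i. i < n \<Longrightarrow> eigs A ! i > 0"
proof -
  note A = posdefD[OF assms]
  obtain as where as: "char_poly A = (\<Prod>a\<leftarrow>as. [:- a, 1:])" "length as = n"
    using char_poly_factorized[OF A(1)] by blast
  have ev: "eigenvalue A a" if "a \<in> set as" for a
  proof -
    have "poly (char_poly A) a = 0"
      unfolding as(1) poly_prod_list using that by (auto simp: prod_list_zero_iff o_def image_iff)
    then show ?thesis using eigenvalue_root_char_poly[OF A(1)] by simp
  qed
  define L where "L = rev (sort (map Re as))"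
  \<comment> \<open>Sorting permutes the linear factors; passing to multisets makes their order
    irrelevant.\<close>
  have "(\<Prod>x\<leftarrow>L. [:- complex_of_real x, 1:]) = prod_mset (image_mset (\<lambda>x. [:- complex_of_real x, 1:]) (mset (map Re as)))"
    unfolding L_def by (simp flip: prod_mset_prod_list)
  also have "\<dots> = (\<Prod>a\<leftarrow>as. [:- complex_of_real (Re a), 1:])"
    by (simp add: image_mset.compositionality o_def flip: prod_mset_prod_list)
  also have "\<dots> = (\<Prod>a\<leftarrow>as. [:- a, 1:])"
    using posdef_eigenvalue_pos(1)[OF assms ev] by (intro arg_cong[of _ _ prod_list] map_cong) auto
  finally have "char_poly A = (\<Prod>x\<leftarrow>L. [:- complex_of_real x, 1:])" using as(1) by simp
  moreover have "sorted_wrt (\<ge>) L"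
    unfolding L_def by (simp add: sorted_wrt_rev)
  ultimately have "\<exists>L. length L = dim_row A \<and> sorted_wrt (\<ge>) L \<and>
      char_poly A = (\<Prod>x\<leftarrow>L. [:- complex_of_real x, 1:])"
    using as(2) A(3) by (intro exI[of _ L]) (auto simp: L_def)
  from someI_ex[OF this, folded eigs_def]
  have E: "length (eigs A) = n" "sorted_wrt (\<ge>) (eigs A)"
    "char_poly A = (\<Prod>x\<leftarrow>eigs A. [:- complex_of_real x, 1:])" using A(3) by auto
  from E show "length (eigs A) = n" "sorted_wrt (\<ge>) (eigs A)" by auto
  have cp: "char_poly A = (\<Prod>e\<leftarrow>map complex_of_real (eigs A). [:- e, 1:])"
    using E(3) by (simp add: o_def)
  from hermitian_diagonalization[OF A(1,2) cp]
  obtain U where U: "U \<in> carrier_mat n n" "U * mat_adjoint U = 1\<^sub>m n" "mat_adjoint U * U = 1\<^sub>m n"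
    "A = U * diag_of n ((!) (map complex_of_real (eigs A))) * mat_adjoint U" by blast
  have "diag_of n ((!) (map complex_of_real (eigs A))) = diag_of n (\<lambda>i. complex_of_real (eigs A ! i))"
    using E(1) by (intro eq_matI) auto
  then show "\<exists>U. spectral_decomp n A U ((!) (eigs A))"
    using U by (intro exI[of _ U]) (auto simp: spectral_decomp_def)
  then obtain U where sd: "spectral_decomp n A U ((!) (eigs A))" by blast
  show "eigs A ! i > 0" if "i < n" for i
    using A(5)[OF spectral_decomp_col(1,2)[OF sd that]] spectral_decomp_col(4)[OF sd that] by simp
qed

lemma posdef_spectral:
  assumes "posdef n A"
  obtains U d where "spectral_decomp n A U d" "\<And>i. i < n \<Longrightarrow> d i > 0"
  using spectral_decomp_eigs[OF assms] by blast

text \<open>The entries of \<open>W = V\<^sup>* U\<close> vanish where the two diagonals disagree, so \<open>W\<close> intertwines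
  every function of them.\<close>

lemma functional_calculus_unique:
  assumes "spectral_decomp n A U d" "spectral_decomp n A V e"
  shows "U * diag_of n (\<lambda>i. complex_of_real (f (d i))) * mat_adjoint U =
    V * diag_of n (\<lambda>i. complex_of_real (f (e i))) * mat_adjoint V"
proof -
  note U = spectral_decompD[OF assms(1)] and V = spectral_decompD[OF assms(2)]
  note ac = square_mult_assoc[of _ n] square_mult_carrier[of _ n]
  define W where "W = mat_adjoint V * U"
  have W: "W \<in> carrier_mat n n" unfolding W_def by (rule square_mult_carrier[OF V(2) U(1)])
  let ?D = "\<lambda>d. diag_of n (\<lambda>i. complex_of_real (d i))"
  have "?D e * W = mat_adjoint V * (V * ?D e * mat_adjoint V) * U"
  proof -
    have "mat_adjoint V * (V * ?D e * mat_adjoint V) * U = (mat_adjoint V * V) * ?D e * W"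
      unfolding W_def using U(1,2) V(1,2) by (simp add: ac)
    then show ?thesis by (simp add: V(4))
  qed
  also have "\<dots> = mat_adjoint V * (U * ?D d * mat_adjoint U) * U"
    using U(5) V(5) by simp
  also have "\<dots> = W * ?D d * (mat_adjoint U * U)"
    unfolding W_def using U(1,2) V(1,2) by (simp add: ac)
  also have "\<dots> = W * ?D d"
    using W by (simp add: U(4))
  finally have WD: "?D e * W = W * ?D d" .
  have WF: "?D (\<lambda>i. f (e i)) * W = W * ?D (\<lambda>i. f (d i))"
  proof (rule eq_matI)
    fix i j assume "i < dim_row (W * ?D (\<lambda>i. f (d i)))" "j < dim_col (W * ?D (\<lambda>i. f (d i)))"
    then have ij: "i < n" "j < n" using W by auto
    have "complex_of_real (e i) * W $$ (i,j) = W $$ (i,j) * complex_of_real (d j)"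
      using arg_cong[OF WD, of "\<lambda>M. M $$ (i,j)"] W ij
      by (simp add: diag_of_mult_left[of _ n n] diag_of_mult_right[of _ n n] del: index_mult_mat(1))
    then have "W $$ (i,j) = 0 \<or> e i = d j" by auto
    then show "(?D (\<lambda>i. f (e i)) * W) $$ (i,j) = (W * ?D (\<lambda>i. f (d i))) $$ (i,j)"
      using W ij
      by (auto simp add: diag_of_mult_left[of _ n n] diag_of_mult_right[of _ n n] simp del: index_mult_mat(1))
  qed (use W in auto)
  have VW: "V * W = U"
  proof -
    have "V * W = (V * mat_adjoint V) * U" unfolding W_def using U(1,2) V(1,2) by (simp add: ac)
    then show ?thesis using U(1) by (simp add: V(3))
  qed
  have WU: "W * mat_adjoint U = mat_adjoint V"
  proof -
    have "W * mat_adjoint U = mat_adjoint V * (U * mat_adjoint U)"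
      unfolding W_def using U(1,2) V(1,2) by (simp add: ac)
    then show ?thesis using right_mult_one_mat[OF V(2)] by (simp add: U(3))
  qed
  have "U * ?D (\<lambda>i. f (d i)) * mat_adjoint U = V * (W * ?D (\<lambda>i. f (d i))) * mat_adjoint U"
    unfolding VW[symmetric] using W V(1,2) U(2) by (simp add: ac)
  also have "\<dots> = V * ?D (\<lambda>i. f (e i)) * (W * mat_adjoint U)"
    unfolding WF[symmetric] using W V(1,2) U(2) by (simp add: ac)
  finally show ?thesis unfolding WU .
qed

text \<open>The definition of \<open>mat_powr\<close> picks some diagonalization. By uniqueness of
  the functional calculus any other one gives the same power, so later proofs may use whichever is
  at hand.\<close>

lemma mat_powr_spectral:
  assumes sd: "spectral_decomp n A U d" and d: "\<And>i. i < n \<Longrightarrow> d i > 0"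
  shows "mat_powr A s = U * diag_of n (\<lambda>i. complex_of_real (d i powr s)) * mat_adjoint U"
proof -
  note U = spectral_decompD[OF sd]
  have n: "dim_row A = n" using U(6) by simp
  have ex: "\<exists>X U d. unitary_mat U \<and> dim_row U = dim_row A \<and> (\<forall>i < dim_row A. d i > 0) \<and>
      A = U * diag_of (dim_row A) (\<lambda>i. complex_of_real (d i)) * mat_adjoint U \<and>
      X = U * diag_of (dim_row A) (\<lambda>i. complex_of_real (d i powr s)) * mat_adjoint U"
    unfolding n using U d by (auto simp: unitary_mat_def)
  from someI_ex[OF ex, folded mat_powr_def]
  obtain V e where V: "unitary_mat V" "dim_row V = n"
    "A = V * diag_of n (\<lambda>i. complex_of_real (e i)) * mat_adjoint V"
    "mat_powr A s = V * diag_of n (\<lambda>i. complex_of_real (e i powr s)) * mat_adjoint V"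
    unfolding n by blast
  have "spectral_decomp n A V e"
    using V by (auto simp: spectral_decomp_def unitary_mat_def)
  from functional_calculus_unique[OF sd this, of "\<lambda>x. x powr s"] show ?thesis by (simp add: V(4))
qed

lemma spectral_decomp_mat_powr:
  assumes "spectral_decomp n A U d" "\<And>i. i < n \<Longrightarrow> d i > 0"
  shows "spectral_decomp n (mat_powr A s) U (\<lambda>i. d i powr s)"
  using spectral_decompD[OF assms(1)] mat_powr_spectral[OF assms] by (simp add: spectral_decomp_def)

lemma posdef_mat_powr:
  assumes "posdef n A" shows "posdef n (mat_powr A s)"
proof -
  obtain U d where "spectral_decomp n A U d" "\<And>i. i < n \<Longrightarrow> d i > 0" using posdef_spectral[OF assms] by blast
  then show ?thesis
    using spectral_decomp_mat_powr[of n A U d s] by (fastforce intro!: spectral_decomp_posdef)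
qed

lemma mat_powr_carrier: "posdef n A \<Longrightarrow> mat_powr A s \<in> carrier_mat n n"
  using posdef_mat_powr posdefD(1) by blast

lemma diag_of_cong: "(\<And>i. i < n \<Longrightarrow> d i = e i) \<Longrightarrow> diag_of n d = diag_of n e"
  by (rule eq_matI) auto

section \<open>Exponent laws, scaling, inverses and determinants\<close>

lemma mat_powr_add:
  assumes "posdef n A"
  shows "mat_powr A a * mat_powr A b = mat_powr A (a + b)"
proof -
  obtain U d where sd: "spectral_decomp n A U d" and d: "\<And>i. i < n \<Longrightarrow> d i > 0"
    using posdef_spectral[OF assms] by blast
  have pw: "mat_powr A s = U * diag_of n (\<lambda>i. complex_of_real (d i powr s)) * mat_adjoint U" for s
    by (rule mat_powr_spectral[OF sd]) (rule d)
  note U = spectral_decompD[OF sd]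
  let ?D = "\<lambda>s. diag_of n (\<lambda>i. complex_of_real (d i powr s))"
  have "mat_powr A a * mat_powr A b = U * (?D a * (mat_adjoint U * U) * ?D b) * mat_adjoint U"
    unfolding pw using U(1,2)
    by (simp add: square_mult_assoc[of _ n] square_mult_carrier[of _ n])
  also have "?D a * (mat_adjoint U * U) * ?D b = ?D (a + b)"
    unfolding U(4) by (simp add: diag_of_mult_diag_of powr_add)
  finally show ?thesis unfolding pw .
qed

lemma mat_powr_zero:
  assumes "posdef n A" shows "mat_powr A 0 = 1\<^sub>m n"
proof -
  obtain U d where sd: "spectral_decomp n A U d" and d: "\<And>i. i < n \<Longrightarrow> d i > 0"
    using posdef_spectral[OF assms] by blast
  have pw: "mat_powr A s = U * diag_of n (\<lambda>i. complex_of_real (d i powr s)) * mat_adjoint U" for s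
    by (rule mat_powr_spectral[OF sd]) (rule d)
  \<comment> \<open>By convention \<open>0 powr 0 = 0\<close>, so the entries are \<open>1\<close>
    because every \<open>d i\<close> is positive.\<close>
  have "diag_of n (\<lambda>i. complex_of_real (d i powr 0)) = 1\<^sub>m n"
    using d by (intro eq_matI) (auto dest: less_imp_neq[OF d])
  then show ?thesis
    unfolding pw using spectral_decompD(1-4)[OF sd] by simp
qed

lemma mat_powr_one:
  assumes "posdef n A" shows "mat_powr A 1 = A"
proof -
  obtain U d where sd: "spectral_decomp n A U d" and d: "\<And>i. i < n \<Longrightarrow> d i > 0"
    using posdef_spectral[OF assms] by blast
  have pw: "mat_powr A s = U * diag_of n (\<lambda>i. complex_of_real (d i powr s)) * mat_adjoint U" for s
    by (rule mat_powr_spectral[OF sd]) (rule d)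
  have "diag_of n (\<lambda>i. complex_of_real (d i powr 1)) = diag_of n (\<lambda>i. complex_of_real (d i))"
    using d by (intro diag_of_cong) (simp add: less_imp_le)
  then show ?thesis
    unfolding pw by (simp flip: spectral_decompD(5)[OF sd])
qed

lemma mat_powr_mat_powr:
  assumes "posdef n A" shows "mat_powr (mat_powr A a) b = mat_powr A (a * b)"
proof -
  obtain U d where sd: "spectral_decomp n A U d" and d: "\<And>i. i < n \<Longrightarrow> d i > 0"
    using posdef_spectral[OF assms] by blast
  have "\<And>i. i < n \<Longrightarrow> 0 < d i powr a" using d by fastforce
  then show ?thesis
    using mat_powr_spectral[OF spectral_decomp_mat_powr[OF sd d]] mat_powr_spectral[OF sd d]
    by (simp add: powr_powr)
qed

lemma mat_powr_smult:
  assumes "posdef n A" "c > 0"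
  shows "mat_powr (complex_of_real c \<cdot>\<^sub>m A) s = complex_of_real (c powr s) \<cdot>\<^sub>m mat_powr A s"
    "posdef n (complex_of_real c \<cdot>\<^sub>m A)"
proof -
  obtain U d where sd: "spectral_decomp n A U d" and d: "\<And>i. i < n \<Longrightarrow> d i > 0"
    using posdef_spectral[OF assms(1)] by blast
  have pw: "mat_powr A s = U * diag_of n (\<lambda>i. complex_of_real (d i powr s)) * mat_adjoint U" for s
    by (rule mat_powr_spectral[OF sd]) (rule d)
  note U = spectral_decompD[OF sd]
  have sm: "U * diag_of n (\<lambda>i. complex_of_real (a * b i)) * mat_adjoint U =
      complex_of_real a \<cdot>\<^sub>m (U * diag_of n (\<lambda>i. complex_of_real (b i)) * mat_adjoint U)" for a b
  proof -
    have "diag_of n (\<lambda>i. complex_of_real (a * b i)) = complex_of_real a \<cdot>\<^sub>m diag_of n (\<lambda>i. complex_of_real (b i))"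
      by (rule eq_matI) auto
    moreover have "U * (complex_of_real a \<cdot>\<^sub>m diag_of n (\<lambda>i. complex_of_real (b i))) =
        complex_of_real a \<cdot>\<^sub>m (U * diag_of n (\<lambda>i. complex_of_real (b i)))"
      using U(1) by (intro mult_smult_distrib[of _ n n _ n]) auto
    moreover have "complex_of_real a \<cdot>\<^sub>m (U * diag_of n (\<lambda>i. complex_of_real (b i))) * mat_adjoint U =
        complex_of_real a \<cdot>\<^sub>m (U * diag_of n (\<lambda>i. complex_of_real (b i)) * mat_adjoint U)"
      using U(1,2) by (intro mult_smult_assoc_mat[of _ n n _ n]) (auto intro: square_mult_carrier)
    ultimately show ?thesis by simp
  qed
  have sd': "spectral_decomp n (complex_of_real c \<cdot>\<^sub>m A) U (\<lambda>i. c * d i)"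
    using U sm[of c d] by (simp add: spectral_decomp_def)
  have d': "\<And>i. i < n \<Longrightarrow> c * d i > 0" using d assms(2) by simp
  show "posdef n (complex_of_real c \<cdot>\<^sub>m A)" using spectral_decomp_posdef[OF sd' d'] .
  have "diag_of n (\<lambda>i. complex_of_real ((c * d i) powr s)) = diag_of n (\<lambda>i. complex_of_real (c powr s * d i powr s))"
    using d assms(2) by (intro diag_of_cong) (simp add: powr_mult less_imp_le)
  then show "mat_powr (complex_of_real c \<cdot>\<^sub>m A) s = complex_of_real (c powr s) \<cdot>\<^sub>m mat_powr A s"
    unfolding pw mat_powr_spectral[OF sd', of s, OF d', simplified] using sm by simp
qed

lemma mat_inv_eq_mat_powr:
  assumes "posdef n A" shows "mat_inv A = mat_powr A (- 1)"
proof -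
  note A = posdefD[OF assms]
  let ?B = "mat_powr A (- 1)"
  have B: "?B \<in> carrier_mat n n" using mat_powr_carrier[OF assms] .
  have "mat_powr A 1 * ?B = 1\<^sub>m n" "?B * mat_powr A 1 = 1\<^sub>m n"
    by (simp_all add: mat_powr_add[OF assms] mat_powr_zero[OF assms])
  then have AB: "A * ?B = 1\<^sub>m n" "?B * A = 1\<^sub>m n" by (simp_all add: mat_powr_one[OF assms])
  show ?thesis
    unfolding mat_inv_def
  proof (rule some_equality)
    show "?B \<in> carrier_mat (dim_row A) (dim_row A) \<and> A * ?B = 1\<^sub>m (dim_row A) \<and> ?B * A = 1\<^sub>m (dim_row A)"
      using A(3) B AB by simp
    fix X assume "X \<in> carrier_mat (dim_row A) (dim_row A) \<and> A * X = 1\<^sub>m (dim_row A) \<and> X * A = 1\<^sub>m (dim_row A)"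
    then have X: "X \<in> carrier_mat n n" "A * X = 1\<^sub>m n" using A(3) by auto
    have "X = (?B * A) * X" using X by (simp add: AB)
    also have "\<dots> = ?B * (A * X)" using A(1) B X(1) by (rule_tac square_mult_assoc)
    finally show "X = ?B" using B by (simp add: X(2))
  qed
qed

text \<open>One positive number \<open>a\<close> serves all exponents, which turns the determinant
  identity of the theorem into a computation with real powers.\<close>

lemma det_mat_powr:
  assumes "posdef n A"
  obtains a where "a > 0" "det A = complex_of_real a" "\<And>s. det (mat_powr A s) = complex_of_real (a powr s)"
proof -
  obtain U d where sd: "spectral_decomp n A U d" and d: "\<And>i. i < n \<Longrightarrow> d i > 0"
    using posdef_spectral[OF assms] by blast
  have pw: "mat_powr A s = U * diag_of n (\<lambda>i. complex_of_real (d i powr s)) * mat_adjoint U" for s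
    by (rule mat_powr_spectral[OF sd]) (rule d)
  note U = spectral_decompD[OF sd]
  have "det U * det (mat_adjoint U) = 1" using det_mult[OF U(1,2)] U(3) by simp
  then have det: "det (U * diag_of n e * mat_adjoint U) = (\<Prod>i<n. e i)" for e
  proof -
    have "det (U * diag_of n e * mat_adjoint U) = det U * det (diag_of n e) * det (mat_adjoint U)"
      using U(1,2) by (simp add: det_mult[of _ n] square_mult_carrier[of _ n])
    also have "det (diag_of n e) = (\<Prod>i<n. e i)"
      by (subst det_upper_triangular[of _ n])
        (auto simp: prod_list_diag_prod atLeast0LessThan)
    finally show ?thesis using \<open>det U * det (mat_adjoint U) = 1\<close> by (simp add: ac_simps)
  qed
  define a where "a = (\<Prod>i<n. d i)"
  have "a > 0" unfolding a_def using d by (intro prod_pos) auto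
  moreover have "det A = complex_of_real a" unfolding U(5) det a_def by simp
  moreover have "det (mat_powr A s) = complex_of_real (a powr s)" for s
    unfolding pw det a_def using d
    by (simp add: prod_powr_distrib less_imp_le)
  ultimately show ?thesis using that by blast
qed

lemma posdef_congr:
  assumes "posdef n H" "posdef n A" shows "posdef n (H * A * H)"
proof -
  note H = posdefD[OF assms(1)] and A = posdefD[OF assms(2)]
  have "mat_adjoint (H * A * H) = H * A * H"
    using H(1,2) A(1,2)
    by (simp add: mat_adjoint_mult[of _ n n _ n] square_mult_assoc[of _ n] square_mult_carrier[of _ n])
  moreover have "quad_form (H * A * H) v > 0" if v: "v \<in> carrier_vec n" "v \<noteq> 0\<^sub>v n" for v
  proof -
    have c: "H *\<^sub>v v \<in> carrier_vec n" using H(1) v(1) by simp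
    have "H *\<^sub>v v \<noteq> 0\<^sub>v n"
    proof
      assume "H *\<^sub>v v = 0\<^sub>v n"
      then have "quad_form H v = 0" using v by (simp add: quad_form_def)
      then show False using H(5)[OF v] by simp
    qed
    then show ?thesis using quad_form_congr[OF A(1) H(1) v(1)] H(2) A(5)[OF c] by simp
  qed
  ultimately show ?thesis using H(1) A(1) by (simp add: posdef_iff square_mult_carrier)
qed

section \<open>The Loewner-Heinz inequality\<close>

text \<open>\<open>loewner_le n c A B\<close> is the Loewner order \<open>A \<le> c B\<close>.\<close>

definition loewner_le :: "nat \<Rightarrow> real \<Rightarrow> complex mat \<Rightarrow> complex mat \<Rightarrow> bool" where
  "loewner_le n c A B \<longleftrightarrow> (\<forall>v \<in> carrier_vec n. quad_form A v \<le> c * quad_form B v)"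

section \<open>Powers acting on vectors, and rules for the Loewner order\<close>

lemma posdef_cscalar:
  assumes "posdef n H" "v \<in> carrier_vec n" "w \<in> carrier_vec n"
  shows "(H *\<^sub>v v) \<bullet>c w = v \<bullet>c (H *\<^sub>v w)"
  using cscalar_mat_adjoint[of H n n v w] posdefD(1,2)[OF assms(1)] assms(2,3) by simp

lemma mat_powr_mult_vec:
  assumes "posdef n A" "v \<in> carrier_vec n"
  shows "mat_powr A a *\<^sub>v (mat_powr A b *\<^sub>v v) = mat_powr A (a + b) *\<^sub>v v"
  using assms by (simp add: assoc_mult_mat_vec[of _ n n _ n, symmetric] mat_powr_carrier mat_powr_add)

lemma mat_powr_mult_vec_carrier:
  "posdef n A \<Longrightarrow> v \<in> carrier_vec n \<Longrightarrow> mat_powr A a *\<^sub>v v \<in> carrier_vec n"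
  using mat_powr_carrier[of n A a] by simp

lemma mat_powr_sandwich:
  assumes "posdef n A"
  shows "mat_powr A a * mat_powr A b * mat_powr A a = mat_powr A (2 * a + b)"
  using assms by (simp add: mat_powr_add algebra_simps)

lemma mat_powr_sandwich_sandwich:
  assumes A: "posdef n A" and X: "X \<in> carrier_mat n n"
  shows "mat_powr A a * (mat_powr A b * X * mat_powr A b) * mat_powr A a =
    mat_powr A (a + b) * X * mat_powr A (a + b)"
proof -
  note c = mat_powr_carrier[OF A]
  have "mat_powr A a * (mat_powr A b * X * mat_powr A b) * mat_powr A a =
      (mat_powr A a * mat_powr A b) * X * (mat_powr A b * mat_powr A a)"
    using c X by (simp add: square_mult_assoc[of _ n] square_mult_carrier[of _ n])
  then show ?thesis using A by (simp add: mat_powr_add add.commute)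
qed

lemma mat_powr_sandwich_cancel:
  assumes "posdef n A" "X \<in> carrier_mat n n" "a + b = 0"
  shows "mat_powr A a * (mat_powr A b * X * mat_powr A b) * mat_powr A a = X"
  using assms by (simp add: mat_powr_sandwich_sandwich mat_powr_zero)

lemma mat_powr_sandwich_one:
  assumes "posdef n A"
  shows "mat_powr A a * 1\<^sub>m n * mat_powr A a = mat_powr A (2 * a)"
  using mat_powr_sandwich[OF assms, of a 0] mat_powr_zero[OF assms] by simp

lemma quad_form_mat_powr:
  assumes "posdef n A" "v \<in> carrier_vec n"
  shows "quad_form (mat_powr A a) v = quad_form (1\<^sub>m n) (mat_powr A (a / 2) *\<^sub>v v)"
proof -
  note P = posdefD[OF posdef_mat_powr[OF assms(1), of "a / 2"]]
  show ?thesis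
    using quad_form_congr[OF one_carrier_mat P(1) assms(2)] P(2) mat_powr_sandwich_one[OF assms(1), of "a / 2"]
    by simp
qed

lemma loewner_le_congr:
  assumes "posdef n H" "A \<in> carrier_mat n n" "B \<in> carrier_mat n n" "loewner_le n c A B"
  shows "loewner_le n c (H * A * H) (H * B * H)"
  unfolding loewner_le_def
proof
  fix v :: "complex vec" assume v: "v \<in> carrier_vec n"
  note H = posdefD[OF assms(1)]
  show "quad_form (H * A * H) v \<le> c * quad_form (H * B * H) v"
    using quad_form_congr[OF assms(2) H(1) v] quad_form_congr[OF assms(3) H(1) v] H(1,2) assms(4) v
    by (simp add: loewner_le_def)
qed

text \<open>The passage between order and spectrum: the columns of \<open>U\<close> as test vectors
  give one direction, Parseval's identity the other. It holds for any diagonalization, so no largest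
  eigenvalue has to be named.\<close>

lemma loewner_le_one_iff:
  assumes "spectral_decomp n A U d"
  shows "loewner_le n c A (1\<^sub>m n) \<longleftrightarrow> (\<forall>i<n. d i \<le> c)"
proof
  assume "loewner_le n c A (1\<^sub>m n)"
  then show "\<forall>i<n. d i \<le> c"
    using spectral_decomp_col[OF assms] by (metis loewner_le_def mult.right_neutral)
next
  assume d: "\<forall>i<n. d i \<le> c"
  show "loewner_le n c A (1\<^sub>m n)"
    unfolding loewner_le_def
  proof
    fix v :: "complex vec" assume v: "v \<in> carrier_vec n"
    show "quad_form A v \<le> c * quad_form (1\<^sub>m n) v"
      unfolding quad_form_spectral[OF assms v] quad_form_spectral[OF spectral_decomp_one[OF assms] v]
        sum_distrib_left
      using d by (intro sum_mono) (auto intro: mult_right_mono simp del: index_mult_mat_vec)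
  qed
qed

lemma loewner_le_trans:
  assumes "loewner_le n a A B" "loewner_le n b B C" "a \<ge> 0"
  shows "loewner_le n (a * b) A C"
  unfolding loewner_le_def
proof
  fix v :: "complex vec" assume v: "v \<in> carrier_vec n"
  have "quad_form A v \<le> a * quad_form B v" using assms(1) v by (simp add: loewner_le_def)
  also have "\<dots> \<le> a * (b * quad_form C v)"
    using assms(2,3) v by (intro mult_left_mono) (auto simp: loewner_le_def)
  finally show "quad_form A v \<le> a * b * quad_form C v" by (simp add: mult.assoc)
qed

text \<open>An additive substitute for Cauchy-Schwarz, summed over coordinates from
  \<open>2 * p * q <= p^2 + q^2\<close>. It is strong enough when both vectors are bounded in norm
  by the same third vector.\<close>

lemma Re_cscalar_le:
  fixes x y :: "complex vec"
  assumes "x \<in> carrier_vec n" "y \<in> carrier_vec n"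
  shows "2 * Re (x \<bullet>c y) \<le> quad_form (1\<^sub>m n) x + quad_form (1\<^sub>m n) y"
proof -
  have "2 * Re (x \<bullet>c y) = (\<Sum>i<n. 2 * Re (x $ i * cnj (y $ i)))"
    using assms by (simp add: scalar_prod_def atLeast0LessThan sum_distrib_left)
  also have "\<dots> \<le> (\<Sum>i<n. (cmod (x $ i))\<^sup>2 + (cmod (y $ i))\<^sup>2)"
  proof (rule sum_mono)
    fix i
    have "Re (x $ i * cnj (y $ i)) \<le> cmod (x $ i) * cmod (y $ i)"
      using complex_Re_le_cmod[of "x $ i * cnj (y $ i)"] by (simp add: norm_mult)
    moreover have "2 * (cmod (x $ i) * cmod (y $ i)) \<le> (cmod (x $ i))\<^sup>2 + (cmod (y $ i))\<^sup>2"
      using sum_squares_bound[of "cmod (x $ i)" "cmod (y $ i)"] by simp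
    ultimately show "2 * Re (x $ i * cnj (y $ i)) \<le> (cmod (x $ i))\<^sup>2 + (cmod (y $ i))\<^sup>2"
      by linarith
  qed
  finally show ?thesis using assms by (simp add: quad_form_one sum.distrib)
qed

text \<open>Pedersen's argument: an eigenvector \<open>v\<close> of \<open>B\<^sup>-\<^sup>q A\<^sup>2\<^sup>q B\<^sup>-\<^sup>q\<close>, with \<open>q = (a + b) / 4\<close>, is moved to
  \<open>z = B\<^bsup>(a - b) / 4\<^esup> v\<close>, where the eigenvalue becomes an inner product of the images of \<open>z\<close> under the two
  contractions \<open>A\<^bsup>a/2\<^esup> B\<^bsup>-a/2\<^esup>\<close> and \<open>A\<^bsup>b/2\<^esup> B\<^bsup>-b/2\<^esup>\<close>.\<close>

lemma loewner_heinz_midpoint: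
  assumes A: "posdef n A" and B: "posdef n B"
    and a: "loewner_le n 1 (mat_powr A a) (mat_powr B a)"
    and b: "loewner_le n 1 (mat_powr A b) (mat_powr B b)"
  shows "loewner_le n 1 (mat_powr A ((a + b) / 2)) (mat_powr B ((a + b) / 2))"
proof -
  define q where "q = (a + b) / 4"
  define M where "M = mat_powr B (- q) * mat_powr A (2 * q) * mat_powr B (- q)"
  note cA = mat_powr_carrier[OF A] and cB = mat_powr_carrier[OF B]
  note vA = mat_powr_mult_vec_carrier[OF A] and vB = mat_powr_mult_vec_carrier[OF B]
  have M: "posdef n M" unfolding M_def by (intro posdef_congr posdef_mat_powr A B)
  then obtain U d where sd: "spectral_decomp n M U d" using posdef_spectral by blast
  have "d i \<le> 1" if i: "i < n" for i
  proof -
    define v where "v = col U i"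
    note v = spectral_decomp_col(1-3)[OF sd i, folded v_def]
    \<comment> \<open>The exponent \<open>(a - b) / 4\<close> is the one for which the power
      \<open>- a / 2\<close> of \<open>B\<close> sends \<open>z\<close> to the power
      \<open>- q\<close> of \<open>B\<close> applied to \<open>v\<close>, while the power
      \<open>b / 2\<close> sends it to the power \<open>q\<close> applied to \<open>v\<close>. One
      vector thus suits both contractions.\<close>
    define z where "z = mat_powr B ((a - b) / 4) *\<^sub>v v"
    have z: "z \<in> carrier_vec n" unfolding z_def by (rule vB[OF v(1)])
    have "z \<noteq> 0\<^sub>v n"
    proof
      assume "z = 0\<^sub>v n"
      then have "mat_powr B ((a - b) / 4) *\<^sub>v v = 0\<^sub>v n" by (simp add: z_def)
      then have "quad_form (mat_powr B ((a - b) / 4)) v = 0"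
        using v by (simp add: quad_form_def)
      then show False using posdefD(5)[OF posdef_mat_powr[OF B] v(1,2), of "(a - b) / 4"] by simp
    qed
    then have zpos: "quad_form (1\<^sub>m n) z > 0" using quad_form_one_pos[OF z] by simp
    define x where "x = mat_powr A (a / 2) *\<^sub>v (mat_powr B (- a / 2) *\<^sub>v z)"
    define y where "y = mat_powr A (b / 2) *\<^sub>v (mat_powr B (- b / 2) *\<^sub>v z)"
    have contr: "quad_form (1\<^sub>m n) (mat_powr A (r / 2) *\<^sub>v (mat_powr B (- r / 2) *\<^sub>v z)) \<le> quad_form (1\<^sub>m n) z"
      if "loewner_le n 1 (mat_powr A r) (mat_powr B r)" for r
    proof -
      have "quad_form (1\<^sub>m n) (mat_powr A (r / 2) *\<^sub>v (mat_powr B (- r / 2) *\<^sub>v z))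
          = quad_form (mat_powr A r) (mat_powr B (- r / 2) *\<^sub>v z)"
        using quad_form_mat_powr[OF A vB[OF z], of r] by simp
      also have "\<dots> \<le> quad_form (mat_powr B r) (mat_powr B (- r / 2) *\<^sub>v z)"
        using that vB[OF z] by (simp add: loewner_le_def)
      also have "\<dots> = quad_form (1\<^sub>m n) z"
        using z by (simp add: quad_form_mat_powr[OF B vB[OF z]] mat_powr_mult_vec[OF B z] mat_powr_zero[OF B])
      finally show ?thesis .
    qed
    have e: "- a / 2 + (a - b) / 4 = - q" "b / 2 + (a - b) / 4 = q" "b / 2 + a / 2 = 2 * q"
      unfolding q_def by (simp_all add: field_simps)
    have p: "mat_powr B (- a / 2) *\<^sub>v z = mat_powr B (- q) *\<^sub>v v"
      unfolding z_def mat_powr_mult_vec[OF B v(1)] by (simp only: e)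
    have Mv: "mat_powr A (2 * q) *\<^sub>v (mat_powr B (- q) *\<^sub>v v) = complex_of_real (d i) \<cdot>\<^sub>v (mat_powr B (b / 2) *\<^sub>v z)"
    proof -
      have "mat_powr B q *\<^sub>v (M *\<^sub>v v) = mat_powr B q *\<^sub>v (mat_powr B (- q) *\<^sub>v (mat_powr A (2 * q) *\<^sub>v (mat_powr B (- q) *\<^sub>v v)))"
        unfolding M_def using cA cB v(1) vA vB
        by (simp add: assoc_mult_mat_vec[of _ n n _ n] square_mult_carrier[of _ n])
      also have "\<dots> = mat_powr A (2 * q) *\<^sub>v (mat_powr B (- q) *\<^sub>v v)"
        using v(1) by (simp add: mat_powr_mult_vec[OF B] vA vB mat_powr_zero[OF B])
      finally have "mat_powr A (2 * q) *\<^sub>v (mat_powr B (- q) *\<^sub>v v) = mat_powr B q *\<^sub>v (complex_of_real (d i) \<cdot>\<^sub>v v)"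
        using v(3) by simp
      also have "\<dots> = complex_of_real (d i) \<cdot>\<^sub>v (mat_powr B q *\<^sub>v v)"
        using cB v(1) by (simp add: mult_mat_vec[of _ n n])
      also have "mat_powr B q *\<^sub>v v = mat_powr B (b / 2) *\<^sub>v z"
        unfolding z_def mat_powr_mult_vec[OF B v(1)] by (simp only: e)
      finally show ?thesis .
    qed
    \<comment> \<open>Moving the power \<open>b / 2\<close> of \<open>A\<close> across the inner
      product joins it to the power \<open>a / 2\<close>. The result is the power
      \<open>2 * q\<close> occurring in \<open>M\<close>, so the eigenvalue equation
      \<open>Mv\<close> applies.\<close>
    have "x \<bullet>c y = (mat_powr A (b / 2) *\<^sub>v x) \<bullet>c (mat_powr B (- b / 2) *\<^sub>v z)"
      unfolding y_def using posdef_cscalar[OF posdef_mat_powr[OF A], of x "mat_powr B (- b / 2) *\<^sub>v z" "b / 2"] z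
      by (simp add: x_def vA vB)
    also have "mat_powr A (b / 2) *\<^sub>v x = mat_powr A (2 * q) *\<^sub>v (mat_powr B (- q) *\<^sub>v v)"
      unfolding x_def p mat_powr_mult_vec[OF A vB[OF v(1)]] by (simp only: e)
    also note Mv
    also have "(complex_of_real (d i) \<cdot>\<^sub>v (mat_powr B (b / 2) *\<^sub>v z)) \<bullet>c (mat_powr B (- b / 2) *\<^sub>v z)
        = complex_of_real (d i) * (z \<bullet>c (mat_powr B (b / 2) *\<^sub>v (mat_powr B (- b / 2) *\<^sub>v z)))"
      using posdef_cscalar[OF posdef_mat_powr[OF B] z vB[OF z], of "b / 2" "- b / 2"] vB[OF z]
      by (simp add: smult_scalar_prod_distrib[of _ n])
    also have "mat_powr B (b / 2) *\<^sub>v (mat_powr B (- b / 2) *\<^sub>v z) = z"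
      using z by (simp add: mat_powr_mult_vec[OF B] mat_powr_zero[OF B])
    also have "Re (complex_of_real (d i) * (z \<bullet>c z)) = d i * quad_form (1\<^sub>m n) z"
      using z by (simp add: quad_form_def)
    finally have "Re (x \<bullet>c y) = d i * quad_form (1\<^sub>m n) z" .
    moreover have "2 * Re (x \<bullet>c y) \<le> quad_form (1\<^sub>m n) x + quad_form (1\<^sub>m n) y"
      by (rule Re_cscalar_le) (simp_all add: x_def y_def vA vB z)
    moreover have "quad_form (1\<^sub>m n) x \<le> quad_form (1\<^sub>m n) z" "quad_form (1\<^sub>m n) y \<le> quad_form (1\<^sub>m n) z"
      unfolding x_def y_def using contr a b by auto
    ultimately have "d i * quad_form (1\<^sub>m n) z \<le> 1 * quad_form (1\<^sub>m n) z" by linarith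
    then show ?thesis using zpos by simp
  qed
  then have "loewner_le n 1 M (1\<^sub>m n)" using loewner_le_one_iff[OF sd] by blast
  from loewner_le_congr[OF posdef_mat_powr[OF B, of q] posdefD(1)[OF M] one_carrier_mat this]
  have "loewner_le n 1 (mat_powr A (2 * q)) (mat_powr B (2 * q))"
    unfolding M_def using mat_powr_sandwich_cancel[OF B cA] mat_powr_sandwich_one[OF B] by simp
  moreover have "2 * q = (a + b) / 2" by (simp add: q_def)
  ultimately show ?thesis by metis
qed

text \<open>Needed for the set of admissible exponents in the Loewner-Heinz inequality to be
  closed.\<close>

lemma continuous_quad_form_mat_powr:
  assumes "posdef n A" "v \<in> carrier_vec n"
  shows "continuous_on UNIV (\<lambda>s. quad_form (mat_powr A s) v)"
proof -
  obtain U d where sd: "spectral_decomp n A U d" and d: "\<And>i. i < n \<Longrightarrow> d i > 0"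
    using posdef_spectral[OF assms(1)] by blast
  have "quad_form (mat_powr A s) v = (\<Sum>i<n. d i powr s * (cmod ((mat_adjoint U *\<^sub>v v) $ i))\<^sup>2)" for s
    using quad_form_spectral[OF spectral_decomp_mat_powr[OF sd d] assms(2)] by simp
  moreover have "d i \<noteq> 0" if "i < n" for i using d[OF that] by simp
  ultimately show ?thesis
    by (auto intro!: continuous_intros simp del: index_mult_mat_vec)
qed

text \<open>The exponents that preserve the order form a closed set \<open>T\<close> containing 0, 1
  and all midpoints of its elements. If \<open>s\<close> were missing, the nearest elements
  \<open>a\<close> and \<open>b\<close> of \<open>T\<close> on its two sides would enclose a gap,
  yet their midpoint lies in \<open>T\<close> strictly between them.\<close>

theorem loewner_heinz_one:
  assumes A: "posdef n A" and B: "posdef n B" and le: "loewner_le n 1 A B" and s: "0 \<le> s" "s \<le> 1"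
  shows "loewner_le n 1 (mat_powr A s) (mat_powr B s)"
proof -
  define T where "T = {s. loewner_le n 1 (mat_powr A s) (mat_powr B s)}"
  have "T = (\<Inter>v \<in> carrier_vec n. {s. quad_form (mat_powr A s) v \<le> quad_form (mat_powr B s) v})"
    by (auto simp: T_def loewner_le_def)
  also have "closed \<dots>"
    by (intro closed_INT ballI closed_Collect_le)
      (auto intro: continuous_quad_form_mat_powr[OF A] continuous_quad_form_mat_powr[OF B])
  finally have closed: "closed T" .
  have mid: "(a + b) / 2 \<in> T" if "a \<in> T" "b \<in> T" for a b
    using that loewner_heinz_midpoint[OF A B] by (simp add: T_def)
  have 0: "0 \<in> T" by (simp add: T_def loewner_le_def mat_powr_zero[OF A] mat_powr_zero[OF B])
  have 1: "1 \<in> T" using le by (simp add: T_def mat_powr_one[OF A] mat_powr_one[OF B])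
  have "compact (T \<inter> {0..s})" "compact (T \<inter> {s..1})"
    using compact_Int_closed[OF compact_Icc closed] by (simp_all add: Int_commute)
  moreover have "T \<inter> {0..s} \<noteq> {}" "T \<inter> {s..1} \<noteq> {}" using 0 1 s by auto
  ultimately obtain a b where a: "a \<in> T \<inter> {0..s}" "\<forall>x \<in> T \<inter> {0..s}. x \<le> a"
    and b: "b \<in> T \<inter> {s..1}" "\<forall>x \<in> T \<inter> {s..1}. b \<le> x"
    using compact_attains_sup compact_attains_inf by metis
  have "a = b"
  proof (rule ccontr)
    assume "a \<noteq> b"
    then have "a < (a + b) / 2" "(a + b) / 2 < b" using a(1) b(1) by auto
    moreover have "(a + b) / 2 \<in> T" using mid a(1) b(1) by auto
    ultimately show False using a b by (cases "(a + b) / 2 \<le> s") force+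
  qed
  then have "s \<in> T" using a(1) b(1) by auto
  then show ?thesis by (simp add: T_def)
qed

lemma quad_form_smult:
  assumes "A \<in> carrier_mat n n" "v \<in> carrier_vec n"
  shows "quad_form (complex_of_real c \<cdot>\<^sub>m A) v = c * quad_form A v"
proof -
  have "(complex_of_real c \<cdot>\<^sub>m A) *\<^sub>v v = complex_of_real c \<cdot>\<^sub>v (A *\<^sub>v v)"
    using assms by (intro eq_vecI) auto
  then show ?thesis using assms by (simp add: quad_form_def)
qed

text \<open>The constant is absorbed into \<open>B\<close> by scaling and comes back as
  \<open>c powr s\<close> when the power is taken.\<close>

theorem loewner_heinz:
  assumes A: "posdef n A" and B: "posdef n B" and le: "loewner_le n c A B" and c: "c > 0"
    and s: "0 \<le> s" "s \<le> 1"
  shows "loewner_le n (c powr s) (mat_powr A s) (mat_powr B s)"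
proof -
  have "loewner_le n 1 A (complex_of_real c \<cdot>\<^sub>m B)"
    using le posdefD(1)[OF B] by (simp add: loewner_le_def quad_form_smult)
  from loewner_heinz_one[OF A mat_powr_smult(2)[OF B c] this s]
  show ?thesis
    by (simp add: loewner_le_def mat_powr_smult(1)[OF B c] quad_form_smult[OF mat_powr_carrier[OF B]])
qed

text \<open>A statement about largest eigenvalues in the form "every bound for one matrix bounds the
  other". Writing \<open>C * A * C\<close> in place of \<open>B\<close> makes it applicable as it
  stands to the compounds of \<open>A\<close> and \<open>C\<close>.\<close>

lemma top_eigenvalue_bound:
  assumes A: "posdef n A" and C: "posdef n C" and s: "0 \<le> s" "s \<le> 1" and mu: "\<mu> > 0"
    and le: "loewner_le n \<mu> (mat_powr (C * A * C) (- s / 2) * mat_powr A (1 + s) *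
      mat_powr (C * A * C) (- s / 2)) (1\<^sub>m n)"
  shows "loewner_le n \<mu> (mat_powr C (- s) * A * mat_powr C (- s)) (1\<^sub>m n)"
proof -
  define B where "B = C * A * C"
  define M where "M = mat_powr C (- s) * A * mat_powr C (- s)"
  have B: "posdef n B" unfolding B_def by (rule posdef_congr[OF C A])
  have M: "posdef n M" unfolding M_def by (rule posdef_congr[OF posdef_mat_powr[OF C] A])
  note cA = posdefD(1)[OF A] and cC = posdefD(1)[OF C] and cM = posdefD(1)[OF M]
  obtain U d where sd: "spectral_decomp n M U d" and d: "\<And>i. i < n \<Longrightarrow> d i > 0"
    using posdef_spectral[OF M] by blast
  show ?thesis
  \<comment> \<open>For \<open>n = 0\<close> there is no eigenvalue to take the maximum of.\<close>
  proof (cases "n = 0")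
    case True
    then show ?thesis using loewner_le_one_iff[OF sd] by (simp add: M_def)
  next
    case False
    define c where "c = Max (d ` {..<n})"
    have "c \<in> d ` {..<n}" unfolding c_def using False by (intro Max_in) auto
    \<comment> \<open>Because the maximum is attained at \<open>j\<close>, every Loewner bound for
      \<open>M\<close> is at least \<open>c\<close>; this is how the leastness of \<open>c\<close>
      is used below.\<close>
    then obtain j where j: "j < n" "c = d j" by auto
    have cmax: "\<forall>i<n. d i \<le> c" unfolding c_def by auto
    have c: "c > 0" using d j by simp
    have "loewner_le n c M (1\<^sub>m n)" using cmax loewner_le_one_iff[OF sd] by blast
    from loewner_le_congr[OF posdef_mat_powr[OF C, of s] cM one_carrier_mat this]
    have AC: "loewner_le n c A (mat_powr C (2 * s))"
      unfolding M_def using mat_powr_sandwich_cancel[OF C cA] mat_powr_sandwich_one[OF C] by simp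
    have "loewner_le n c B (mat_powr C (2 + 2 * s))"
    proof -
      have "C * mat_powr C (2 * s) * C = mat_powr C (2 + 2 * s)"
        using mat_powr_sandwich[OF C, of 1 "2 * s"] by (simp add: mat_powr_one[OF C])
      then show ?thesis
        using loewner_le_congr[OF C cA mat_powr_carrier[OF C] AC] by (simp add: B_def)
    qed
    from loewner_heinz[OF B posdef_mat_powr[OF C] this c s]
    have BC: "loewner_le n (c powr s) (mat_powr B s) (mat_powr C ((2 + 2 * s) * s))"
      by (simp add: mat_powr_mat_powr[OF C])
    have "loewner_le n \<mu> (mat_powr A (1 + s)) (mat_powr B s)"
      using loewner_le_congr[OF posdef_mat_powr[OF B, of "s / 2"] _ one_carrier_mat le]
        mat_powr_sandwich_cancel[OF B mat_powr_carrier[OF A], of "s / 2" "- s / 2" "1 + s"]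
        mat_powr_sandwich_one[OF B, of "s / 2"] mat_powr_carrier[OF A] mat_powr_carrier[OF B]
      by (simp add: square_mult_carrier flip: B_def)
    from loewner_le_trans[OF this BC] mu
    have "loewner_le n (\<mu> * c powr s) (mat_powr A (1 + s)) (mat_powr C ((2 + 2 * s) * s))" by simp
    then have "loewner_le n ((\<mu> * c powr s) powr (1 / (1 + s)))
        (mat_powr (mat_powr A (1 + s)) (1 / (1 + s))) (mat_powr (mat_powr C ((2 + 2 * s) * s)) (1 / (1 + s)))"
      using mu c s by (intro loewner_heinz posdef_mat_powr A C) (auto simp: field_simps)
    \<comment> \<open>The exponent of \<open>C\<close> returns to the one in \<open>AC\<close>, so
      the new bound can be compared with \<open>c\<close>.\<close>
    moreover have "(2 + 2 * s) * s * (1 / (1 + s)) = 2 * s" using s by (simp add: field_simps)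
    moreover have "(1 + s) * (1 / (1 + s)) = 1" using s by simp
    ultimately have "loewner_le n ((\<mu> * c powr s) powr (1 / (1 + s))) A (mat_powr C (2 * s))"
      by (simp only: mat_powr_mat_powr[OF A] mat_powr_mat_powr[OF C] mat_powr_one[OF A])
    from loewner_le_congr[OF posdef_mat_powr[OF C, of "- s"] cA mat_powr_carrier[OF C] this]
    have "loewner_le n ((\<mu> * c powr s) powr (1 / (1 + s))) M (1\<^sub>m n)"
      using mat_powr_sandwich[OF C, of "- s" "2 * s"] by (simp add: M_def mat_powr_zero[OF C])
    then have "c \<le> (\<mu> * c powr s) powr (1 / (1 + s))"
      using loewner_le_one_iff[OF sd] j by blast
    then have "c powr (1 + s) \<le> ((\<mu> * c powr s) powr (1 / (1 + s))) powr (1 + s)"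
      using c s by (intro powr_mono2) auto
    also have "\<dots> = \<mu> * c powr s" using mu c s by (simp add: powr_powr)
    finally have "c * c powr s \<le> \<mu> * c powr s" using c by (simp add: powr_add)
    then have "c \<le> \<mu>" using c by simp
    then have "\<forall>i<n. d i \<le> \<mu>" using cmax by force
    then show ?thesis using loewner_le_one_iff[OF sd] by (simp add: M_def)
  qed
qed

section \<open>Compound matrices\<close>

text \<open>For \<open>a < n choose k\<close>, the injection \<open>subset_index n k a\<close> enumerates the \<open>a\<close>-th \<open>k\<close>-element subset
  of \<open>{..<n}\<close>, in no particular order.\<close>

definition subset_index :: "nat \<Rightarrow> nat \<Rightarrow> nat \<Rightarrow> nat \<Rightarrow> nat" where
  "subset_index n k = (SOME r. (\<forall>a < n choose k. inj_on (r a) {..<k}) \<and>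
     bij_betw (\<lambda>a. r a ` {..<k}) {..<n choose k} {S. S \<subseteq> {..<n} \<and> card S = k})"

text \<open>The index maps may repeat values: the multilinear expansion in
  \<open>cauchy_binet\<close> produces such minors before they are discarded as zero.\<close>

definition minor_mat :: "nat \<Rightarrow> (nat \<Rightarrow> nat) \<Rightarrow> (nat \<Rightarrow> nat) \<Rightarrow> complex mat \<Rightarrow> complex mat" where
  "minor_mat k f g A = mat k k (\<lambda>(i,j). A $$ (f i, g j))"

text \<open>The matrix of the \<open>k\<close>-th exterior power of \<open>A\<close>. Another
  enumeration of the subsets would conjugate it by a signed permutation matrix, which leaves its
  spectrum unchanged.\<close>

definition compound :: "nat \<Rightarrow> nat \<Rightarrow> complex mat \<Rightarrow> complex mat" where
  "compound n k A = mat (n choose k) (n choose k)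
     (\<lambda>(a,b). det (minor_mat k (subset_index n k a) (subset_index n k b) A))"

lemma subset_index:
  shows "a < n choose k \<Longrightarrow> inj_on (subset_index n k a) {..<k}"
    "bij_betw (\<lambda>a. subset_index n k a ` {..<k}) {..<n choose k} {S. S \<subseteq> {..<n} \<and> card S = k}"
proof -
  let ?S = "{S. S \<subseteq> {..<n} \<and> card S = k}"
  have fin: "finite ?S" by (rule finite_subset[of _ "Pow {..<n}"]) auto
  have card: "card ?S = n choose k" using n_subsets[of "{..<n}" k] by simp
  obtain e where e: "bij_betw e {..<n choose k} ?S"
    using ex_bij_betw_nat_finite[OF fin] by (auto simp: card atLeast0LessThan)
  have "\<exists>h. bij_betw h {..<k} S" if "S \<in> ?S" for S
  proof -
    have "finite S" using that finite_subset[of S "{..<n}"] by simp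
    then show ?thesis using ex_bij_betw_nat_finite[of S] that by (simp add: atLeast0LessThan)
  qed
  then obtain h where h: "\<And>S. S \<in> ?S \<Longrightarrow> bij_betw (h S) {..<k} S" by metis
  define r where "r a = h (e a)" for a
  have r: "bij_betw (r a) {..<k} (e a)" if "a < n choose k" for a
    unfolding r_def using that e by (intro h) (auto simp: bij_betw_def)
  have "bij_betw (\<lambda>a. r a ` {..<k}) {..<n choose k} ?S"
    using e r by (subst bij_betw_cong[of _ _ e]) (auto simp: bij_betw_def)
  then have ex: "\<exists>r. (\<forall>a < n choose k. inj_on (r a) {..<k}) \<and>
     bij_betw (\<lambda>a. r a ` {..<k}) {..<n choose k} ?S"
    using r by (intro exI[of _ r]) (auto simp: bij_betw_def)
  note * = someI_ex[OF ex, folded subset_index_def]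
  from * show "a < n choose k \<Longrightarrow> inj_on (subset_index n k a) {..<k}" by blast
  from * show "bij_betw (\<lambda>a. subset_index n k a ` {..<k}) {..<n choose k} ?S" by blast
qed

lemma subset_index_less:
  assumes "a < n choose k" "i < k" shows "subset_index n k a i < n"
proof -
  have "subset_index n k a ` {..<k} \<in> {S. S \<subseteq> {..<n} \<and> card S = k}"
    using bij_betwE[OF subset_index(2)[of n k]] assms(1) by blast
  then show ?thesis using assms(2) by auto
qed

lemma subset_index_surj:
  assumes "S \<subseteq> {..<n}" "card S = k"
  obtains a where "a < n choose k" "subset_index n k a ` {..<k} = S"
proof -
  have "S \<in> (\<lambda>a. subset_index n k a ` {..<k}) ` {..<n choose k}"
    using bij_betw_imp_surj_on[OF subset_index(2)[of n k]] assms by simp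
  then show ?thesis using that by auto
qed

lemma subset_index_inj:
  assumes "a < n choose k" "b < n choose k" "subset_index n k a ` {..<k} = subset_index n k b ` {..<k}"
  shows "a = b"
  using inj_onD[OF bij_betw_imp_inj_on[OF subset_index(2)[of n k]]] assms by simp

section \<open>Minors of a product\<close>

lemma minor_mat_carrier [simp]: "minor_mat k f g A \<in> carrier_mat k k"
  by (simp add: minor_mat_def)

text \<open>An injection of \<open>{0..<k}\<close> into \<open>{0..<n}\<close> amounts to its image
  together with an ordering of that image. The maps are the identity outside \<open>{0..<k}\<close>
  to match the index set in the multilinear expansion of a determinant.\<close>

lemma bij_betw_subset_permutation:
  "bij_betw (\<lambda>(a, p) i. if i < k then subset_index n k a (p i) else i)
     ({..<n choose k} \<times> {p. p permutes {0..<k}})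
     {g. (\<forall>i\<in>{0..<k}. g i \<in> {0..<n}) \<and> (\<forall>i. i \<notin> {0..<k} \<longrightarrow> g i = i) \<and> inj_on g {0..<k}}"
  (is "bij_betw ?\<Phi> ?D ?R")
proof -
  have im: "?\<Phi> (a, p) ` {0..<k} = subset_index n k a ` {..<k}" if "p permutes {0..<k}" for a p
  proof -
    have "?\<Phi> (a, p) ` {0..<k} = subset_index n k a ` (p ` {0..<k})"
      by (auto simp: image_image)
    then show ?thesis using permutes_image[OF that] by (simp add: atLeast0LessThan)
  qed
  have "inj_on ?\<Phi> ?D"
  proof (rule inj_onI, clarsimp)
    fix a p b q
    assume a: "a < n choose k" and b: "b < n choose k" and p: "p permutes {0..<k}" and q: "q permutes {0..<k}"
      and eq: "(\<lambda>i. if i < k then subset_index n k a (p i) else i) =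
        (\<lambda>i. if i < k then subset_index n k b (q i) else i)"
    have "a = b" using im[OF p, of a] im[OF q, of b] eq a b by (intro subset_index_inj) auto
    moreover have "p i = q i" for i
    proof (cases "i < k")
      case True
      then have "subset_index n k a (p i) = subset_index n k a (q i)"
        using fun_cong[OF eq, of i] \<open>a = b\<close> by simp
      then show ?thesis
        using inj_onD[OF subset_index(1)[OF a], of "p i" "q i"]
          permutes_in_image[OF p, of i] permutes_in_image[OF q, of i] True
        by simp
    next
      case False
      then show ?thesis using permutes_not_in[OF p, of i] permutes_not_in[OF q, of i] by simp
    qed
    ultimately show "a = b \<and> p = q" by blast
  qed
  moreover have "?\<Phi> ` ?D \<subseteq> ?R"
  proof clarsimp
    fix a p assume a: "a < n choose k" and p: "p permutes {0..<k}"
    have pk: "p i < k" if "i < k" for i using permutes_in_image[OF p, of i] that by simp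
    have "inj_on (\<lambda>i. if i < k then subset_index n k a (p i) else i) {0..<k}"
    proof (rule inj_onI)
      fix i j
      assume ij: "i \<in> {0..<k}" "j \<in> {0..<k}"
        "(if i < k then subset_index n k a (p i) else i) = (if j < k then subset_index n k a (p j) else j)"
      then have "p i = p j" using inj_onD[OF subset_index(1)[OF a], of "p i" "p j"] pk by simp
      then show "i = j" using permutes_inj[OF p] by (simp add: inj_eq)
    qed
    then show "(\<forall>i\<in>{0..<k}. subset_index n k a (p i) < n) \<and>
        inj_on (\<lambda>i. if i < k then subset_index n k a (p i) else i) {0..<k}"
      using subset_index_less[OF a] pk by auto
  qed
  moreover have "?R \<subseteq> ?\<Phi> ` ?D"
  proof
    fix g assume g: "g \<in> ?R"
    have "card (g ` {0..<k}) = k" using g by (auto simp: card_image)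
    moreover have "g ` {0..<k} \<subseteq> {..<n}" using g by auto
    ultimately obtain a where a: "a < n choose k" "subset_index n k a ` {..<k} = g ` {0..<k}"
      using subset_index_surj by metis
    note inj = subset_index(1)[OF a(1)]
    define p where "p i = (if i < k then inv_into {..<k} (subset_index n k a) (g i) else i)" for i
    have rp: "subset_index n k a (p i) = g i" "p i < k" if "i < k" for i
    proof -
      have "g i \<in> subset_index n k a ` {..<k}" using a(2) that by auto
      then show "subset_index n k a (p i) = g i" "p i < k"
        using that f_inv_into_f[of "g i" "subset_index n k a"] inv_into_into[of "g i" "subset_index n k a" "{..<k}"]
        by (auto simp: p_def)
    qed
    have "inj_on p {0..<k}"
    proof (rule inj_onI)
      fix i j assume "i \<in> {0..<k}" "j \<in> {0..<k}" "p i = p j"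
      then show "i = j" using rp(1)[of i] rp(1)[of j] g by (auto simp: inj_on_def)
    qed
    moreover have "p ` {0..<k} \<subseteq> {0..<k}" using rp(2) by auto
    ultimately have "bij_betw p {0..<k} {0..<k}"
      using endo_inj_surj[of "{0..<k}" p] by (auto simp: bij_betw_def)
    then have "p permutes {0..<k}" by (rule bij_imp_permutes) (simp add: p_def)
    moreover have "g = ?\<Phi> (a, p)" using rp(1) g by auto
    ultimately show "g \<in> ?\<Phi> ` ?D" using a(1) by blast
  qed
  ultimately show ?thesis by (auto simp: bij_betw_def)
qed

text \<open>Each row of the product is a combination of rows of \<open>B\<close>, so the determinant
  expands over all choices \<open>g\<close> of these rows. Choices with a repetition vanish; the
  others are grouped by image, and within a group the signs of the permutations assemble the minor
  of \<open>A\<close>.\<close>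

theorem cauchy_binet:
  assumes A: "A \<in> carrier_mat n n" and B: "B \<in> carrier_mat n n"
    and f: "\<And>i. i < k \<Longrightarrow> f i < n" and h: "\<And>i. i < k \<Longrightarrow> h i < n"
  shows "det (minor_mat k f h (A * B)) =
    (\<Sum>a < n choose k. det (minor_mat k f (subset_index n k a) A) * det (minor_mat k (subset_index n k a) h B))"
proof -
  let ?r = "subset_index n k"
  let ?F = "{g. (\<forall>i\<in>{0..<k}. g i \<in> {0..<n}) \<and> (\<forall>i. i \<notin> {0..<k} \<longrightarrow> g i = i)}"
  let ?R = "{g. (\<forall>i\<in>{0..<k}. g i \<in> {0..<n}) \<and> (\<forall>i. i \<notin> {0..<k} \<longrightarrow> g i = i) \<and> inj_on g {0..<k}}"
  let ?b = "\<lambda>m. vec k (\<lambda>j. B $$ (m, h j))"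
  let ?t = "\<lambda>g. (\<Prod>i = 0..<k. A $$ (f i, g i)) * det (minor_mat k g h B)"
  have rows: "minor_mat k f h (A * B) =
      mat\<^sub>r k k (\<lambda>i. finsum_vec TYPE(complex) k (\<lambda>m. A $$ (f i, m) \<cdot>\<^sub>v ?b m) {0..<n})"
    using A B f h
    by (intro eq_matI) (auto simp: minor_mat_def scalar_prod_def index_finsum_vec intro!: sum.cong)
  have "det (minor_mat k f h (A * B)) = (\<Sum>g\<in>?F. det (mat\<^sub>r k k (\<lambda>i. A $$ (f i, g i) \<cdot>\<^sub>v ?b (g i))))"
    unfolding rows by (rule det_linear_rows_sum) auto
  also have "\<dots> = (\<Sum>g\<in>?F. ?t g)"
  proof (rule sum.cong[OF refl])
    fix g
    have "det (mat\<^sub>r k k (\<lambda>i. A $$ (f i, g i) \<cdot>\<^sub>v ?b (g i))) =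
        (\<Prod>i = 0..<k. A $$ (f i, g i)) * det (mat\<^sub>r k k (\<lambda>i. ?b (g i)))"
      by (rule det_rows_mul) auto
    also have "mat\<^sub>r k k (\<lambda>i. ?b (g i)) = minor_mat k g h B"
      by (intro eq_matI) (auto simp: minor_mat_def)
    finally show "det (mat\<^sub>r k k (\<lambda>i. A $$ (f i, g i) \<cdot>\<^sub>v ?b (g i))) = ?t g" .
  qed
  also have "\<dots> = (\<Sum>g\<in>?R. ?t g)"
  proof (rule sum.mono_neutral_right)
    show "finite ?F" by (rule finite_bounded_functions) auto
    show "?R \<subseteq> ?F" by auto
    show "\<forall>g \<in> ?F - ?R. ?t g = 0"
    proof
      fix g assume "g \<in> ?F - ?R"
      then obtain i j where ij: "i < k" "j < k" "i \<noteq> j" "g i = g j" by (auto simp: inj_on_def)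
      have "det (minor_mat k g h B) = 0"
        using ij by (intro det_identical_rows[OF minor_mat_carrier ij(3)]) (auto simp: minor_mat_def)
      then show "?t g = 0" by simp
    qed
  qed
  also have "\<dots> = (\<Sum>(a, p) \<in> {..<n choose k} \<times> {p. p permutes {0..<k}}.
      ?t (\<lambda>i. if i < k then ?r a (p i) else i))"
    by (subst sum.reindex_bij_betw[OF bij_betw_subset_permutation, symmetric]) (simp add: case_prod_unfold)
  also have "\<dots> = (\<Sum>a < n choose k. \<Sum>p | p permutes {0..<k}. ?t (\<lambda>i. if i < k then ?r a (p i) else i))"
    by (rule sum.cartesian_product[symmetric])
  also have "\<dots> = (\<Sum>a < n choose k. det (minor_mat k f (?r a) A) * det (minor_mat k (?r a) h B))"
  proof (rule sum.cong[OF refl])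
    fix a
    have "?t (\<lambda>i. if i < k then ?r a (p i) else i) =
        signof p * (\<Prod>i = 0..<k. minor_mat k f (?r a) A $$ (i, p i)) * det (minor_mat k (?r a) h B)"
      if p: "p permutes {0..<k}" for p
    proof -
      have pk: "p i < k" if "i < k" for i using permutes_in_image[OF p, of i] that by simp
      have "minor_mat k (\<lambda>i. if i < k then ?r a (p i) else i) h B =
          mat k k (\<lambda>(i,j). minor_mat k (?r a) h B $$ (p i, j))"
        using pk by (intro eq_matI) (auto simp: minor_mat_def)
      then have "det (minor_mat k (\<lambda>i. if i < k then ?r a (p i) else i) h B) = signof p * det (minor_mat k (?r a) h B)"
        using det_permute_rows[OF minor_mat_carrier p] by simp
      moreover have "(\<Prod>i = 0..<k. A $$ (f i, if i < k then ?r a (p i) else i)) =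
          (\<Prod>i = 0..<k. minor_mat k f (?r a) A $$ (i, p i))"
        using pk by (intro prod.cong) (auto simp: minor_mat_def)
      ultimately show ?thesis by (simp only: ac_simps)
    qed
    then show "(\<Sum>p | p permutes {0..<k}. ?t (\<lambda>i. if i < k then ?r a (p i) else i)) =
        det (minor_mat k f (?r a) A) * det (minor_mat k (?r a) h B)"
      by (simp add: det_def'[OF minor_mat_carrier[of k f "?r a" A]] sum_distrib_right)
  qed
  finally show ?thesis .
qed

section \<open>Algebra and spectra of compounds\<close>

lemma compound_carrier [simp]: "compound n k A \<in> carrier_mat (n choose k) (n choose k)"
  by (simp add: compound_def)

lemma compound_mult:
  assumes "A \<in> carrier_mat n n" "B \<in> carrier_mat n n"
  shows "compound n k (A * B) = compound n k A * compound n k B"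
  using cauchy_binet[OF assms] subset_index_less
  by (intro eq_matI) (auto simp: compound_def scalar_prod_def atLeast0LessThan)

lemma compound_adjoint:
  assumes A: "A \<in> carrier_mat n n"
  shows "compound n k (mat_adjoint A) = mat_adjoint (compound n k A)"
proof (rule eq_matI)
  fix a b
  assume "a < dim_row (mat_adjoint (compound n k A))" "b < dim_col (mat_adjoint (compound n k A))"
  then have ab: "a < n choose k" "b < n choose k" by (auto simp: compound_def)
  let ?M = "minor_mat k (subset_index n k b) (subset_index n k a) A"
  let ?M' = "minor_mat k (subset_index n k a) (subset_index n k b) (mat_adjoint A)"
  \<comment> \<open>Expanding this minor by columns and \<open>?M\<close> by rows makes the terms
    match permutation by permutation.\<close>
  have "det ?M' = (\<Sum>p | p permutes {0..<k}. signof p * (\<Prod>j<k. ?M' $$ (p j, j)))"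
    by (rule det_col) simp
  also have "\<dots> = (\<Sum>p | p permutes {0..<k}. cnj (signof p * (\<Prod>j = 0..<k. ?M $$ (j, p j))))"
  proof (rule sum.cong[OF refl])
    fix p assume "p \<in> {p. p permutes {0..<k}}"
    then have p: "p permutes {0..<k}" by simp
    have pk: "p i < k" if "i < k" for i using permutes_in_image[OF p, of i] that by simp
    have "(\<Prod>j<k. ?M' $$ (p j, j)) = (\<Prod>j<k. cnj (?M $$ (j, p j)))"
      using pk A ab subset_index_less by (intro prod.cong) (auto simp: minor_mat_def)
    then show "signof p * (\<Prod>j<k. ?M' $$ (p j, j)) = cnj (signof p * (\<Prod>j = 0..<k. ?M $$ (j, p j)))"
      by (simp add: atLeast0LessThan sign_def)
  qed
  also have "\<dots> = cnj (det ?M)"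
    unfolding det_def'[OF minor_mat_carrier[of k "subset_index n k b" "subset_index n k a" A]] by simp
  finally show "compound n k (mat_adjoint A) $$ (a,b) = mat_adjoint (compound n k A) $$ (a,b)"
    using ab by (simp add: compound_def)
qed (simp_all add: compound_def)

text \<open>Two different subsets of equal size do not contain each other, so some row index of the
  minor is missing among its column indices and that row is zero. For equal subsets the minor is
  itself diagonal, because the enumeration is injective.\<close>

lemma compound_diag:
  "compound n k (diag_of n d) = diag_of (n choose k) (\<lambda>a. \<Prod>i<k. d (subset_index n k a i))"
proof (rule eq_matI)
  let ?r = "subset_index n k"
  fix a b
  assume "a < dim_row (diag_of (n choose k) (\<lambda>a. \<Prod>i<k. d (?r a i)))"
    "b < dim_col (diag_of (n choose k) (\<lambda>a. \<Prod>i<k. d (?r a i)))"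
  then have ab: "a < n choose k" "b < n choose k" by auto
  let ?M = "minor_mat k (?r a) (?r b) (diag_of n d)"
  have "det ?M = (if a = b then \<Prod>i<k. d (?r a i) else 0)"
  proof (cases "a = b")
    case True
    have "upper_triangular ?M"
    proof (rule upper_triangularI)
      fix i j assume "j < i" "i < dim_row ?M"
      then have ij: "j < i" "i < k" by (auto simp: minor_mat_def)
      then have "?r a i \<noteq> ?r a j" using inj_onD[OF subset_index(1)[OF ab(1)], of i j] by auto
      then show "?M $$ (i,j) = 0" using ij True subset_index_less[OF ab(1)] by (simp add: minor_mat_def)
    qed
    then have "det ?M = prod_list (diag_mat ?M)" by (rule det_upper_triangular) (rule minor_mat_carrier)
    also have "\<dots> = (\<Prod>i<k. d (?r a i))"
      using True subset_index_less[OF ab(1)]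
      by (auto simp: prod_list_diag_prod minor_mat_def atLeast0LessThan intro!: prod.cong)
    finally show ?thesis using True by simp
  next
    case False
    have "card (?r a ` {..<k}) = card (?r b ` {..<k})"
      using subset_index(1)[OF ab(1)] subset_index(1)[OF ab(2)] by (simp add: card_image)
    moreover have "?r a ` {..<k} \<noteq> ?r b ` {..<k}" using subset_index_inj[OF ab] False by blast
    ultimately have "\<not> ?r a ` {..<k} \<subseteq> ?r b ` {..<k}"
      by (metis card_subset_eq finite_imageI finite_lessThan)
    then obtain i where i: "i < k" "\<And>j. j < k \<Longrightarrow> ?r a i \<noteq> ?r b j" by auto
    have "det ?M = (\<Sum>p | p permutes {0..<k}. signof p * (\<Prod>i = 0..<k. ?M $$ (i, p i)))"
      by (rule det_def') simp
    also have "\<dots> = 0"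
    proof (intro sum.neutral ballI)
      fix p assume "p \<in> {p. p permutes {0..<k}}"
      then have "p i < k" using permutes_in_image[of p "{0..<k}" i] i(1) by simp
      then have "?M $$ (i, p i) = 0"
        using i subset_index_less[OF ab(1)] subset_index_less[OF ab(2)] by (simp add: minor_mat_def)
      then have "(\<Prod>i = 0..<k. ?M $$ (i, p i)) = 0" using i(1) by (intro prod_zero) auto
      then show "signof p * (\<Prod>i = 0..<k. ?M $$ (i, p i)) = 0" by simp
    qed
    finally show ?thesis using False by simp
  qed
  then show "compound n k (diag_of n d) $$ (a,b) = diag_of (n choose k) (\<lambda>a. \<Prod>i<k. d (?r a i)) $$ (a,b)"
    using ab by (simp add: compound_def)
qed (simp_all add: compound_def)

lemma compound_one: "compound n k (1\<^sub>m n) = 1\<^sub>m (n choose k)"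
  using compound_diag[of n k "\<lambda>_. 1"] by (simp add: diag_of_one)

lemma spectral_decomp_compound:
  assumes "spectral_decomp n A U d"
  shows "spectral_decomp (n choose k) (compound n k A) (compound n k U) (\<lambda>a. \<Prod>i<k. d (subset_index n k a i))"
proof -
  note U = spectral_decompD[OF assms]
  have "compound n k U * mat_adjoint (compound n k U) = 1\<^sub>m (n choose k)"
    "mat_adjoint (compound n k U) * compound n k U = 1\<^sub>m (n choose k)"
    using compound_mult[OF U(1,2), of k] compound_mult[OF U(2,1), of k] U(3,4)
    by (simp_all add: compound_one compound_adjoint[OF U(1)])
  moreover have "compound n k A = compound n k U *
      diag_of (n choose k) (\<lambda>a. complex_of_real (\<Prod>i<k. d (subset_index n k a i))) * mat_adjoint (compound n k U)"
    unfolding U(5) using U(1,2)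
    by (simp add: compound_mult square_mult_carrier compound_adjoint compound_diag)
  ultimately show ?thesis by (simp add: spectral_decomp_def)
qed

lemma posdef_compound:
  assumes "posdef n A" shows "posdef (n choose k) (compound n k A)"
proof -
  obtain U d where sd: "spectral_decomp n A U d" and d: "\<And>i. i < n \<Longrightarrow> d i > 0"
    using posdef_spectral[OF assms] by blast
  show ?thesis
    using subset_index_less d by (intro spectral_decomp_posdef[OF spectral_decomp_compound[OF sd]] prod_pos) auto
qed

lemma compound_mat_powr:
  assumes "posdef n A" shows "compound n k (mat_powr A s) = mat_powr (compound n k A) s"
proof -
  obtain U d where sd: "spectral_decomp n A U d" and d: "\<And>i. i < n \<Longrightarrow> d i > 0"
    using posdef_spectral[OF assms] by blast
  let ?e = "\<lambda>a. \<Prod>i<k. d (subset_index n k a i)"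
  have dpos: "d (subset_index n k a i) > 0" if "a < n choose k" "i < k" for a i
    using d subset_index_less that by blast
  have "compound n k (mat_powr A s) = compound n k U *
      diag_of (n choose k) (\<lambda>a. complex_of_real (\<Prod>i<k. d (subset_index n k a i) powr s)) * mat_adjoint (compound n k U)"
    using spectral_decompD(5)[OF spectral_decomp_compound[OF spectral_decomp_mat_powr[OF sd d]]] by simp
  also have "diag_of (n choose k) (\<lambda>a. complex_of_real (\<Prod>i<k. d (subset_index n k a i) powr s)) =
      diag_of (n choose k) (\<lambda>a. complex_of_real (?e a powr s))"
    by (intro diag_of_cong arg_cong[of _ _ complex_of_real] prod_powr_distrib[symmetric])
  also have "compound n k U * \<dots> * mat_adjoint (compound n k U) = mat_powr (compound n k A) s"
    using dpos by (intro mat_powr_spectral[symmetric] spectral_decomp_compound[OF sd] prod_pos) auto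
  finally show ?thesis .
qed

text \<open>An exchange argument: \<open>S - K\<close> and \<open>K - S\<close> have the same size,
  and the last initial value \<open>m = L (k - 1)\<close> separates them, bounding the factors over
  \<open>S - K\<close> from above and those over \<open>K - S\<close> from below. The case
  \<open>k = 0\<close>, where this index has no meaning, is split off.\<close>

lemma prod_subset_le_prod_initial:
  fixes L :: "nat \<Rightarrow> real"
  assumes anti: "\<And>i j. i \<le> j \<Longrightarrow> j < n \<Longrightarrow> L j \<le> L i" and pos: "\<And>i. i < n \<Longrightarrow> L i > 0"
    and S: "S \<subseteq> {..<n}" "card S = k"
  shows "(\<Prod>i\<in>S. L i) \<le> (\<Prod>i<k. L i)"
proof (cases "k = 0")
  case True
  then show ?thesis using S finite_subset[OF S(1)] by simp
next
  case False
  have fin: "finite S" using S(1) finite_subset by blast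
  have kn: "k \<le> n" using card_mono[OF _ S(1)] S(2) by simp
  define K where "K = {..<k}"
  define m where "m = L (k - 1)"
  have m: "m > 0" using pos False kn by (simp add: m_def)
  have "card (S - K) = card (K - S)"
    using card_Diff_subset_Int[of S K] card_Diff_subset_Int[of K S] fin S(2) by (simp add: K_def Int_commute)
  have "(\<Prod>i\<in>S - K. L i) \<le> (\<Prod>i\<in>S - K. m)"
    using S(1) pos anti False by (intro prod_mono) (force simp: K_def m_def intro: less_imp_le)
  also have "\<dots> = (\<Prod>i\<in>K - S. m)" by (simp add: \<open>card (S - K) = card (K - S)\<close>)
  also have "\<dots> \<le> (\<Prod>i\<in>K - S. L i)"
    using anti m kn False by (intro prod_mono) (auto simp: K_def m_def)
  finally have le: "(\<Prod>i\<in>S - K. L i) \<le> (\<Prod>i\<in>K - S. L i)" .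
  have "(\<Prod>i\<in>S. L i) = (\<Prod>i\<in>S \<inter> K. L i) * (\<Prod>i\<in>S - K. L i)"
    using fin by (metis prod.Int_Diff)
  also have "\<dots> \<le> (\<Prod>i\<in>S \<inter> K. L i) * (\<Prod>i\<in>K - S. L i)"
    using le pos S(1) by (intro mult_left_mono prod_nonneg) (auto intro: less_imp_le)
  also have "\<dots> = (\<Prod>i\<in>K. L i)"
    using prod.Int_Diff[of K L S] by (simp add: K_def Int_commute)
  finally show ?thesis by (simp add: K_def)
qed

text \<open>The bound to transfer is the product for \<open>Y\<close> itself: it dominates every
  eigenvalue of the compound of \<open>Y\<close>, hence of that of \<open>X\<close>, and one of the
  latter is the product over the subset \<open>{..<k}\<close>.\<close>

lemma prod_eigs_le_if_compound:
  assumes X: "posdef n X" and Y: "posdef n Y" and k: "k \<le> n"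
    and imp: "\<And>\<mu>. \<mu> > 0 \<Longrightarrow> loewner_le (n choose k) \<mu> (compound n k Y) (1\<^sub>m (n choose k)) \<Longrightarrow>
      loewner_le (n choose k) \<mu> (compound n k X) (1\<^sub>m (n choose k))"
  shows "(\<Prod>j<k. eigs X ! j) \<le> (\<Prod>j<k. eigs Y ! j)"
proof -
  note eX = spectral_decomp_eigs[OF X] and eY = spectral_decomp_eigs[OF Y]
  obtain U V where U: "spectral_decomp n X U ((!) (eigs X))" and V: "spectral_decomp n Y V ((!) (eigs Y))"
    using eX(1) eY(1) by blast
  let ?r = "subset_index n k"
  define \<mu> where "\<mu> = (\<Prod>j<k. eigs Y ! j)"
  have mu: "\<mu> > 0" unfolding \<mu>_def using eY(4) k by (intro prod_pos) auto
  have reindex: "(\<Prod>i<k. L (?r a i)) = (\<Prod>i \<in> ?r a ` {..<k}. L i)" if "a < n choose k" for a and L :: "nat \<Rightarrow> real"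
    using subset_index(1)[OF that] by (simp add: prod.reindex)
  have "(\<Prod>i<k. eigs Y ! ?r a i) \<le> \<mu>" if a: "a < n choose k" for a
    unfolding reindex[OF a, of "(!) (eigs Y)"] \<mu>_def
  proof (rule prod_subset_le_prod_initial)
    show "eigs Y ! j \<le> eigs Y ! i" if "i \<le> j" "j < n" for i j
      using eY(2,3) that by (cases "i = j") (auto simp: sorted_wrt_iff_nth_less)
    show "?r a ` {..<k} \<subseteq> {..<n}" using subset_index_less[OF a] by auto
    show "card (?r a ` {..<k}) = k" using subset_index(1)[OF a] by (simp add: card_image)
  qed (rule eY(4))
  then have "loewner_le (n choose k) \<mu> (compound n k Y) (1\<^sub>m (n choose k))"
    using loewner_le_one_iff[OF spectral_decomp_compound[OF V]] by blast
  from imp[OF mu this] have le: "\<forall>a < n choose k. (\<Prod>i<k. eigs X ! ?r a i) \<le> \<mu>"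
    using loewner_le_one_iff[OF spectral_decomp_compound[OF U]] by blast
  obtain a where a: "a < n choose k" "?r a ` {..<k} = {..<k}"
    using subset_index_surj[of "{..<k}" n k] k by auto
  have "(\<Prod>i<k. eigs X ! ?r a i) = (\<Prod>j<k. eigs X ! j)"
    using reindex[OF a(1), of "(!) (eigs X)"] by (simp add: a(2))
  then show ?thesis using le a(1) by (metis \<mu>_def)
qed

section \<open>Log-majorization\<close>

text \<open>With \<open>R = P * Q\<close> and \<open>S = Q * P\<close> the two matrices are
  \<open>R * S\<close> and \<open>S * R\<close>, which are similar through the invertible
  \<open>R\<close>. The chosen list \<open>eigs\<close> depends only on dimension and characteristic
  polynomial, so the lists agree literally.\<close>

lemma eigs_sandwich_commute:
  assumes P: "posdef n P" and Q: "posdef n Q"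
  shows "eigs (P * (Q * Q) * P) = eigs (Q * (P * P) * Q)"
proof -
  note cP = posdefD(1)[OF P] and cQ = posdefD(1)[OF Q]
  note cPi = mat_powr_carrier[OF P, of "- 1"] and cQi = mat_powr_carrier[OF Q, of "- 1"]
  note ac = square_mult_assoc[of _ n] square_mult_carrier[of _ n]
  let ?Pi = "mat_powr P (- 1)" and ?Qi = "mat_powr Q (- 1)"
  have inv: "P * ?Pi = 1\<^sub>m n" "?Pi * P = 1\<^sub>m n" "Q * ?Qi = 1\<^sub>m n" "?Qi * Q = 1\<^sub>m n"
    using mat_powr_add[OF P, of 1 "- 1"] mat_powr_add[OF P, of "- 1" 1]
      mat_powr_add[OF Q, of 1 "- 1"] mat_powr_add[OF Q, of "- 1" 1]
    by (simp_all add: mat_powr_zero[OF P] mat_powr_one[OF P] mat_powr_zero[OF Q] mat_powr_one[OF Q])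
  have r: "(P * Q) * (?Qi * ?Pi) = 1\<^sub>m n"
  proof -
    have "(P * Q) * (?Qi * ?Pi) = P * (Q * ?Qi) * ?Pi" using cP cQ cPi cQi by (simp add: ac)
    then show ?thesis using cP by (simp add: inv)
  qed
  have l: "(?Qi * ?Pi) * (P * Q) = 1\<^sub>m n"
    using mat_mult_left_right_inverse[OF _ _ r] cP cQ cPi cQi by (simp add: ac)
  have "(P * Q) * (Q * (P * P) * Q) * (?Qi * ?Pi) = P * (Q * Q) * P * ((P * Q) * (?Qi * ?Pi))"
    using cP cQ cPi cQi by (simp add: ac)
  also have "\<dots> = P * (Q * Q) * P" unfolding r using cP by simp
  finally have eq: "P * (Q * Q) * P = (P * Q) * (Q * (P * P) * Q) * (?Qi * ?Pi)" by simp
  have "similar_mat (P * (Q * Q) * P) (Q * (P * P) * Q)"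
    unfolding similar_mat_def similar_mat_wit_def Let_def
    using eq r l cP cQ cPi cQi
    by (intro exI[of _ "P * Q"] exI[of _ "?Qi * ?Pi"]) (simp add: square_mult_carrier[of _ n])
  then have "char_poly (P * (Q * Q) * P) = char_poly (Q * (P * P) * Q)" by (rule char_poly_similar)
  then show ?thesis using cP cQ by (simp add: eigs_def)
qed

lemma prod_eigs_le:
  assumes A: "posdef n A" and C: "posdef n C" and s: "0 \<le> s" "s \<le> 1" and k: "k \<le> n"
  shows "(\<Prod>j<k. eigs (mat_powr C (- s) * A * mat_powr C (- s)) ! j) \<le>
    (\<Prod>j<k. eigs (mat_powr (C * A * C) (- s / 2) * mat_powr A (1 + s) * mat_powr (C * A * C) (- s / 2)) ! j)"
proof (rule prod_eigs_le_if_compound[OF _ _ k])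
  have B: "posdef n (C * A * C)" by (rule posdef_congr[OF C A])
  show "posdef n (mat_powr C (- s) * A * mat_powr C (- s))"
    by (rule posdef_congr[OF posdef_mat_powr[OF C] A])
  show "posdef n (mat_powr (C * A * C) (- s / 2) * mat_powr A (1 + s) * mat_powr (C * A * C) (- s / 2))"
    by (rule posdef_congr[OF posdef_mat_powr[OF B] posdef_mat_powr[OF A]])
  note c = posdefD(1)[OF A] posdefD(1)[OF C] posdefD(1)[OF B]
    mat_powr_carrier[OF A] mat_powr_carrier[OF B] mat_powr_carrier[OF C]
  note cm = compound_mult[of _ n] square_mult_carrier[of _ n]
  let ?K = "compound n k"
  have X: "?K (mat_powr C (- s) * A * mat_powr C (- s)) = mat_powr (?K C) (- s) * ?K A * mat_powr (?K C) (- s)"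
    using c by (simp add: cm compound_mat_powr[OF C])
  have "?K (C * A * C) = ?K C * ?K A * ?K C"
    using c(1,2) by (simp add: cm square_mult_assoc[of _ "n choose k"])
  then have Y: "?K (mat_powr (C * A * C) (- s / 2) * mat_powr A (1 + s) * mat_powr (C * A * C) (- s / 2)) =
      mat_powr (?K C * ?K A * ?K C) (- s / 2) * mat_powr (?K A) (1 + s) * mat_powr (?K C * ?K A * ?K C) (- s / 2)"
    using compound_mult[OF square_mult_carrier[OF c(5,4)] c(5), of k "- s / 2" "1 + s" "- s / 2"]
      compound_mult[OF c(5,4), of k "- s / 2" "1 + s"]
    by (simp only: compound_mat_powr[OF A] compound_mat_powr[OF B])
  show "loewner_le (n choose k) \<mu> (?K (mat_powr C (- s) * A * mat_powr C (- s))) (1\<^sub>m (n choose k))"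
    if "\<mu> > 0" "loewner_le (n choose k) \<mu> (?K (mat_powr (C * A * C) (- s / 2) * mat_powr A (1 + s) *
      mat_powr (C * A * C) (- s / 2))) (1\<^sub>m (n choose k))" for \<mu>
    using top_eigenvalue_bound[OF posdef_compound[OF A] posdef_compound[OF C] s that(1)] that(2)
    unfolding X Y by blast
qed

text \<open>The Riccati equation of the geometric mean, and together with positivity all that is
  used about it. The inner powers of \<open>P\<close> cancel, the two square roots of
  \<open>Z\<close> combine to \<open>Z\<close>, and the outer roots of \<open>P\<close> then undo
  the definition of \<open>Z\<close>.\<close>

lemma geo_mean_riccati:
  assumes P: "posdef n P" and B: "posdef n B"
  shows "posdef n (geo_mean P B)" "geo_mean P B * mat_powr P (- 1) * geo_mean P B = B"
proof -
  define Z where "Z = mat_powr P (- 1 / 2) * B * mat_powr P (- 1 / 2)"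
  have Z: "posdef n Z" unfolding Z_def by (rule posdef_congr[OF posdef_mat_powr[OF P] B])
  have G: "geo_mean P B = mat_powr P (1 / 2) * mat_powr Z (1 / 2) * mat_powr P (1 / 2)"
    by (simp add: geo_mean_def Z_def)
  show "posdef n (geo_mean P B)"
    unfolding G by (rule posdef_congr[OF posdef_mat_powr[OF P] posdef_mat_powr[OF Z]])
  let ?R = "mat_powr P (1 / 2)" and ?S = "mat_powr Z (1 / 2)"
  note c = mat_powr_carrier[OF P] mat_powr_carrier[OF Z]
  have "geo_mean P B * mat_powr P (- 1) * geo_mean P B =
      ?R * (?S * (?R * mat_powr P (- 1) * ?R) * ?S) * ?R"
    unfolding G using c by (simp add: square_mult_assoc[of _ n] square_mult_carrier[of _ n])
  also have "?R * mat_powr P (- 1) * ?R = 1\<^sub>m n"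
    using mat_powr_sandwich[OF P, of "1 / 2" "- 1"] mat_powr_zero[OF P] by simp
  also have "?S * 1\<^sub>m n * ?S = Z"
    using mat_powr_sandwich_one[OF Z, of "1 / 2"] mat_powr_one[OF Z] by simp
  also have "?R * Z * ?R = B"
    unfolding Z_def using posdefD(1)[OF B] by (intro mat_powr_sandwich_cancel[OF P]) simp_all
  finally show "geo_mean P B * mat_powr P (- 1) * geo_mean P B = B" .
qed

text \<open>Determinants turn \<open>CAC\<close> into \<open>b = c * a * c\<close>, and both sides
  become \<open>a\<close> times the square of \<open>c powr t\<close>.\<close>

lemma det_sp_hat_eq:
  assumes A: "posdef n A" and C: "posdef n C" and B: "posdef n B" and CAC: "C * A * C = B"
  shows "det (mat_powr C t * A * mat_powr C t) =
    det (mat_powr A ((1 - t) / 2) * mat_powr B t * mat_powr A ((1 - t) / 2))"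
proof -
  obtain a where a: "a > 0" "det A = complex_of_real a" "\<And>s. det (mat_powr A s) = complex_of_real (a powr s)"
    using det_mat_powr[OF A] by blast
  obtain b where b: "b > 0" "det B = complex_of_real b" "\<And>s. det (mat_powr B s) = complex_of_real (b powr s)"
    using det_mat_powr[OF B] by blast
  obtain c where c: "c > 0" "det C = complex_of_real c" "\<And>s. det (mat_powr C s) = complex_of_real (c powr s)"
    using det_mat_powr[OF C] by blast
  have det3: "det (H * X * H) = det H * det X * det H" if "H \<in> carrier_mat n n" "X \<in> carrier_mat n n"
    for H X :: "complex mat"
    using that by (simp add: det_mult[of _ n] square_mult_carrier[of _ n])
  have "complex_of_real b = complex_of_real (c * a * c)"
    using det3[OF posdefD(1)[OF C] posdefD(1)[OF A]] CAC by (simp add: a b c)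
  then have bca: "b = c * a * c" by (simp only: of_real_eq_iff)
  have "b powr t = c powr t * a powr t * c powr t" unfolding bca using a c by (simp add: powr_mult)
  moreover have "a powr ((1 - t) / 2) * a powr t * a powr ((1 - t) / 2) = a"
  proof -
    have "a powr ((1 - t) / 2) * a powr t * a powr ((1 - t) / 2) = a powr ((1 - t) / 2 + t + (1 - t) / 2)"
      by (simp only: powr_add)
    also have "(1 - t) / 2 + t + (1 - t) / 2 = 1" by (simp add: field_simps)
    finally show ?thesis using a(1) by simp
  qed
  ultimately have "c powr t * a * c powr t = a powr ((1 - t) / 2) * b powr t * a powr ((1 - t) / 2)"
    by (simp add: ac_simps)
  then show ?thesis
    using det3[OF mat_powr_carrier[OF C] posdefD(1)[OF A]] det3[OF mat_powr_carrier[OF A] mat_powr_carrier[OF B]]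
    by (simp add: a b c flip: of_real_mult)
qed

theorem theorem4p3:
  fixes A B :: "complex mat" and n :: nat and t :: real
  assumes "A \<in> carrier_mat n n" and "B \<in> carrier_mat n n"
    and "pos_def_mat A" and "pos_def_mat B"
    and "t \<in> {-1/2..0} \<union> {1..3/2}"
  shows "log_majorized (sp_hat t A B)
           (mat_powr A ((1 - t) / 2) * mat_powr B t * mat_powr A ((1 - t) / 2))"
proof -
  have A: "posdef n A" and B: "posdef n B" using assms by (simp_all add: posdef_def)
  define C where "C = geo_mean (mat_inv A) B"
  have inv: "mat_inv A = mat_powr A (- 1)" by (rule mat_inv_eq_mat_powr[OF A])
  have C: "posdef n C"
    unfolding C_def inv by (rule geo_mean_riccati(1)[OF posdef_mat_powr[OF A] B])
  have CAC: "C * A * C = B"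
    using geo_mean_riccati(2)[OF posdef_mat_powr[OF A, of "- 1"] B]
    by (simp add: C_def inv mat_powr_mat_powr[OF A] mat_powr_one[OF A])
  define X where "X = mat_powr C t * A * mat_powr C t"
  define Y where "Y = mat_powr A ((1 - t) / 2) * mat_powr B t * mat_powr A ((1 - t) / 2)"
  have X: "sp_hat t A B = X" by (simp add: sp_hat_def X_def C_def)
  have dimX: "dim_row X = n" using posdefD(3)[OF posdef_congr[OF posdef_mat_powr[OF C] A]] by (simp add: X_def)
  have "(\<Prod>j<k. eigs X ! j) \<le> (\<Prod>j<k. eigs Y ! j)" if k: "k \<le> n" for k
  proof (cases "t \<le> 0")
    case True
    \<comment> \<open>Turning the product inside out brings the powers of \<open>B\<close> to the
      outside, as \<open>prod_eigs_le\<close> requires with \<open>s = - t\<close>.\<close>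
    have "eigs Y = eigs (mat_powr B (t / 2) * mat_powr A (1 - t) * mat_powr B (t / 2))"
      using eigs_sandwich_commute[OF posdef_mat_powr[OF A] posdef_mat_powr[OF B], of "(1 - t) / 2" "t / 2"]
      by (simp add: Y_def mat_powr_add[OF A] mat_powr_add[OF B])
    then show ?thesis
      using prod_eigs_le[OF A C _ _ k, of "- t"] True assms(5) by (simp add: X_def CAC)
  next
    case False
    \<comment> \<open>With \<open>s = t - 1\<close> the matrix \<open>Y\<close> already has its
      outer factors in the required form, powers of \<open>D * B * D = A\<close>. On the other side,
      the power \<open>t - 1\<close> of \<open>C\<close> around \<open>B = C * A * C\<close> merges
      to the power \<open>t\<close> around \<open>A\<close>, which is \<open>X\<close>.\<close>
    define D where "D = mat_powr C (- 1)"
    have D: "posdef n D" unfolding D_def by (rule posdef_mat_powr[OF C])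
    have C1: "mat_powr C 1 = C" by (rule mat_powr_one[OF C])
    have "D * B * D = A"
      using mat_powr_sandwich_cancel[OF C posdefD(1)[OF A], of "- 1" 1] by (simp add: D_def C1 CAC)
    moreover have "mat_powr D (- (t - 1)) * B * mat_powr D (- (t - 1)) = X"
      using mat_powr_sandwich_sandwich[OF C posdefD(1)[OF A], of "t - 1" 1]
      by (simp add: D_def mat_powr_mat_powr[OF C] C1 CAC X_def)
    moreover have "- (t - 1) / 2 = (1 - t) / 2" "1 + (t - 1) = t" by simp_all
    ultimately show ?thesis
      using prod_eigs_le[OF B D _ _ k, of "t - 1"] False assms(5) unfolding Y_def by auto
  qed
  moreover have "det X = det Y" unfolding X_def Y_def by (rule det_sp_hat_eq[OF A C B CAC])
  ultimately show ?thesis by (auto simp: log_majorized_def X dimX simp flip: Y_def)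
qed

end
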